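(* Let $S\subset\mathbb{R}^3$ be a manifold boundary element, let $\mathbf{r}_p\in\mathbb{R}^3$ be an evaluation point, let $k\neq 0$ be the wavenumber, and let $\mathbf{r}_q\in S$ be a point at which $\boldsymbol{\rho}\neq \mathbf{0}$. With $r,h,\boldsymbol{\rho},\rho,\hat{\boldsymbol{\rho}},\tilde{\boldsymbol{\rho}},\mathbf{n}_q$, the normal curvatures $\kappa_N(\hat{\boldsymbol{\rho}}),\kappa_N(\tilde{\boldsymbol{\rho}})$ of $S$ at $\mathbf{r}_q$, and the Green functions $G_{\mathrm{L}}$ (Laplace) and $G_{\mathrm{H}}$ (Helmholtz) as defined in the context, one has for both $\mathrm{K}=\mathrm{L}$ and $\mathrm{K}=\mathrm{H}$ $$G_{\mathrm{K}}(\mathbf{r}_p,\mathbf{r}_q) = (\nabla_{\mathbf{r}_q}\times \mathbf{f}_{\mathrm{K}})\cdot\mathbf{n}_q + \frac{1}{4\pi}\left(C_{\mathrm{K}}\,\kappa_N(\tilde{\boldsymbol{\rho}})+D_{\mathrm{K}}\,\kappa_N(\hat{\boldsymbol{\rho}})\right),$$ $$\frac{\partial G_{\mathrm{K}}(\mathbf{r}_p,\mathbf{r}_q)}{\partial \mathbf{n}_q} = (\nabla_{\mathbf{r}_q}\times \mathbf{f}'_{\mathrm{K}})\cdot\mathbf{n}_q + \frac{1}{4\pi}\left(C'_{\mathrm{K}}\,\kappa_N(\tilde{\boldsymbol{\rho}})+D'_{\mathrm{K}}\,\kappa_N(\hat{\boldsymbol{\rho}})\right),$$ where $$\mathbf{f}_{\mathrm{L}}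 = \frac{\rho\,\tilde{\boldsymbol{\rho}}}{4\pi(r+h)},\quad C_{\mathrm{L}}=\frac{h}{r+h},\quad D_{\mathrm{L}}=\frac{r}{r+h},$$ $$\mathbf{f}'_{\mathrm{L}} = \frac{\mathbf{f}_{\mathrm{L}}}{r},\quad C'_{\mathrm{L}}=\frac{C_{\mathrm{L}}}{r},\quad D'_{\mathrm{L}}=\frac{D_{\mathrm{L}}}{r},$$ $$\mathbf{f}_{\mathrm{H}} = \frac{e^{ikr}-e^{ikh}}{4\pi i k\rho}\,\tilde{\boldsymbol{\rho}},\quad C_{\mathrm{H}}=\frac{h(e^{ikr}-e^{ikh})}{ik\rho^2},\quad D_{\mathrm{H}}=e^{ikh}-\frac{h(e^{ikr}-e^{ikh})}{ik\rho^2},$$ $$\mathbf{f}'_{\mathrm{H}} = \frac{r e^{ikh}-h e^{ikr}}{4\pi r\rho}\,\tilde{\boldsymbol{\rho}},\quad C'_{\mathrm{H}}=\frac{h\left(r e^{ikh}-h e^{ikr}\right)}{r\rho^2},\quad D'_{\mathrm{H}}=\frac{r e^{ikr}-h e^{ikh}}{\rho^2}-ik e^{ikh}.$$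
   Context: Manifold boundary element: $S$ is an oriented two-dimensional smooth Riemannian submanifold with boundary of $\mathbb{R}^3$, given by a smooth regular parametrization $\mathbf{r}_q(u,v)\in\mathbb{R}^3$ over the reference triangle $\{(u,v): 0\le u,\ 0\le v,\ u+v\le 1\}$. The unit normal at $\mathbf{r}_q$ is $\mathbf{n}_q = (\partial_u\mathbf{r}_q\times\partial_v\mathbf{r}_q)/|\partial_u\mathbf{r}_q\times\partial_v\mathbf{r}_q|$. For a fixed evaluation point $\mathbf{r}_p\in\mathbb{R}^3$ and $\mathbf{r}_q\in S$ define $r = |\mathbf{r}_q-\mathbf{r}_p|$; $h=\mathbf{n}_q\cdot(\mathbf{r}_p-\mathbf{r}_q)$; $\boldsymbol{\rho} = \mathbf{r}_q-\check{\mathbf{r}}_p = \mathbf{r}_q-\mathbf{r}_p+h\,\mathbf{n}_q$, where $\check{\mathbf{r}}_p$ is the orthogonal projection of $\mathbf{r}_p$ onto the tangent plane of $S$ at $\mathbf{r}_q$; $\rho=|\boldsymbol{\rho}|$ (so $r^2=\rho^2+h^2$); $\hat{\boldsymbol{\rho}}=\boldsymbol{\rho}/|\boldsymbol{\rho}|$; $\tilde{\boldsymbol{\rho}}=\mathbf{n}_q\times\hat{\boldsymbol{\rho}}$. All of these are functions of the point $\mathbf{r}_q\in S$. Green functions: $G_{\mathrm{L}}(\mathbf{r}_p,\mathbf{r}_q)=\dfrac{1}{4\pi r}$ and $G_{\mathrm{H}}(\mathbf{r}_p,\mathbf{r}_q)=\dfrac{e^{ikr}}{4\pi r}$. The normal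 derivative is $\partial G/\partial\mathbf{n}_q=\mathbf{n}_q\cdot\nabla_{\mathbf{r}_q}G$, the gradient being with respect to $\mathbf{r}_q$. Normal curvature: for a unit tangent vector $\mathbf{t}$ of $S$ at $\mathbf{r}_q$, $\kappa_N(\mathbf{t})$ is the normal curvature of $S$ at $\mathbf{r}_q$ in direction $\mathbf{t}$, i.e. $\kappa_N=\kappa\,\mathbf{n}(c)\cdot\mathbf{n}_q$ where $c$ is the section curve of $S$ by the normal plane spanned by $\mathbf{n}_q$ and $\mathbf{t}$, $\kappa$ is its curvature and $\mathbf{n}(c)$ its unit principal normal. Equivalently, $\kappa_N(\mathbf{t})$ is the second fundamental form (with coefficients $\partial_{uu}\mathbf{r}_q\cdot\mathbf{n}_q$, $\partial_{uv}\mathbf{r}_q\cdot\mathbf{n}_q$, $\partial_{vv}\mathbf{r}_q\cdot\mathbf{n}_q$) evaluated at $\mathbf{t}$; equivalently $\kappa_N(\mathbf{t})=-\mathbf{t}\cdot d\mathbf{n}(\mathbf{t})$, where $d\mathbf{n}$ is the differential of the normal field. Curl on the surface: each field $\mathbf{f}$ above is a tangential vector field on $S$ (where $\rho\ne0$), a function of $\mathbf{r}_q\in S$ with $\mathbf{r}_p$ fixed. The quantity $(\nabla_{\mathbf{r}_q}\times\mathbf{f})\cdot\mathbf{n}_q$ involves only derivatives of $\mathbf{f}$ along $S$: it is the scalar surface curl, i.e. the function such that $(\nabla_{\mathbf{r}_q}\times\mathbf{f})\cdot\mathbf{n}_q\,dS = d(\mathbf{f}\cdot d\mathbf{l})$ as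 2-forms on $S$. In the parametrization, $(\nabla_{\mathbf{r}_q}\times\mathbf{f})\cdot\mathbf{n}_q = \frac{1}{J}\left(\partial_u\mathbf{f}\cdot\partial_v\mathbf{r}_q-\partial_v\mathbf{f}\cdot\partial_u\mathbf{r}_q\right)$ with $J=|\partial_u\mathbf{r}_q\times\partial_v\mathbf{r}_q|$. *)

theory Defs
  imports "HOL-Analysis.Analysis"
begin

section \<open>Manifold boundary elements\<close>

definition ref_triangle :: "(real \<times> real) set" where
  "ref_triangle = {(u, v). 0 \<le> u \<and> 0 \<le> v \<and> u + v \<le> 1}"

text \<open>Class \<open>C\<^sup>k\<close> on an open set of a finite-dimensional space.\<close>

primrec Ck_on :: "nat \<Rightarrow> ('a::euclidean_space \<Rightarrow> 'b::real_normed_vector) \<Rightarrow> 'a set \<Rightarrow> bool" where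
  "Ck_on 0 f U \<longleftrightarrow> continuous_on U f"
| "Ck_on (Suc k) f U \<longleftrightarrow>
     (\<forall>x\<in>U. f differentiable (at x)) \<and>
     (\<forall>d. Ck_on k (\<lambda>x. frechet_derivative f (at x) d) U)"

text \<open>Smoothness on a set that need not be open: existence of a smooth extension to an open
  neighbourhood.\<close>

definition smooth_on :: "'a::euclidean_space set \<Rightarrow> ('a \<Rightarrow> 'b::real_normed_vector) \<Rightarrow> bool" where
  "smooth_on T f \<longleftrightarrow>
     (\<exists>U g. open U \<and> T \<subseteq> U \<and> (\<forall>k. Ck_on k g U) \<and> (\<forall>x\<in>T. g x = f x))"

text \<open>All fields below are functions of the surface point \<open>q\<close>. Their partial derivatives are taken in
  the parametrization \<open>X\<close>, through the Frechet derivative relative to the closed triangle: it is unique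
  also on the edges and at the corners, where a two-sided or one-sided difference quotient along a
  coordinate line may be unavailable.\<close>

definition surf_deriv ::
  "(real \<times> real \<Rightarrow> real^3) \<Rightarrow> real \<times> real \<Rightarrow> (real^3 \<Rightarrow> 'b::real_normed_vector) \<Rightarrow> real^3 \<Rightarrow> 'b" where
  "surf_deriv X d f q =
     frechet_derivative (\<lambda>w. f (X w)) (at (inv_into ref_triangle X q) within ref_triangle) d"

abbreviation "du X \<equiv> surf_deriv X (1, 0)"
abbreviation "dv X \<equiv> surf_deriv X (0, 1)"

definition tan_u :: "(real \<times> real \<Rightarrow> real^3) \<Rightarrow> real^3 \<Rightarrow> real^3" where
  "tan_u X = du X (\<lambda>q. q)"

definition tan_v :: "(real \<times> real \<Rightarrow> real^3) \<Rightarrow> real^3 \<Rightarrow> real^3" where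
  "tan_v X = dv X (\<lambda>q. q)"

definition boundary_element :: "(real^3) set \<Rightarrow> (real \<times> real \<Rightarrow> real^3) \<Rightarrow> bool" where
  "boundary_element S X \<longleftrightarrow>
     S = X ` ref_triangle \<and> inj_on X ref_triangle \<and> smooth_on ref_triangle X \<and>
     (\<forall>q\<in>S. cross3 (tan_u X q) (tan_v X q) \<noteq> 0)"

definition area_factor :: "(real \<times> real \<Rightarrow> real^3) \<Rightarrow> real^3 \<Rightarrow> real" where
  "area_factor X q = norm (cross3 (tan_u X q) (tan_v X q))"

definition unit_normal :: "(real \<times> real \<Rightarrow> real^3) \<Rightarrow> real^3 \<Rightarrow> real^3" where
  "unit_normal X q = cross3 (tan_u X q) (tan_v X q) /\<^sub>R area_factor X q"

text \<open>The second fundamental form at the tangent vector \<open>t = a *\<^sub>R tan_u X q + b *\<^sub>R tan_v X q\<close>; for a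
  unit vector \<open>t\<close> this is the normal curvature in direction \<open>t\<close>.\<close>

definition normal_curvature :: "(real \<times> real \<Rightarrow> real^3) \<Rightarrow> real^3 \<Rightarrow> real^3 \<Rightarrow> real" where
  "normal_curvature X q t =
     (THE \<kappa>. \<exists>a b. t = a *\<^sub>R tan_u X q + b *\<^sub>R tan_v X q \<and>
        \<kappa> = (du X (tan_u X) q \<bullet> unit_normal X q) * a\<^sup>2
          + 2 * (dv X (tan_u X) q \<bullet> unit_normal X q) * a * b
          + (dv X (tan_v X) q \<bullet> unit_normal X q) * b\<^sup>2)"

section \<open>Vector calculus for real and complex fields\<close>

text \<open>Bilinear (not sesquilinear) product of a real vector with a real or complex one.\<close>

definition vdot :: "real^'n \<Rightarrow> ('a::real_normed_vector)^'n \<Rightarrow> 'a" where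
  "vdot a b = (\<Sum>i\<in>UNIV. (a $ i) *\<^sub>R (b $ i))"

definition grad :: "(real^'n \<Rightarrow> 'a::real_normed_vector) \<Rightarrow> real^'n \<Rightarrow> 'a^'n" where
  "grad f x = (\<chi> i. frechet_derivative f (at x) (axis i 1))"

definition normal_deriv ::
  "(real \<times> real \<Rightarrow> real^3) \<Rightarrow> (real^3 \<Rightarrow> 'a::real_normed_vector) \<Rightarrow> real^3 \<Rightarrow> 'a" where
  "normal_deriv X g q = vdot (unit_normal X q) (grad g q)"

text \<open>\<open>(\<nabla> \<times> f) \<bullet> n\<close>, the density of \<open>d (f \<bullet> dl)\<close> with respect to the area form.\<close>

definition surface_curl ::
  "(real \<times> real \<Rightarrow> real^3) \<Rightarrow> (real^3 \<Rightarrow> ('a::real_normed_vector)^3) \<Rightarrow> real^3 \<Rightarrow> 'a" where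
  "surface_curl X f q =
     (vdot (tan_v X q) (du X f q) - vdot (tan_u X q) (dv X f q)) /\<^sub>R area_factor X q"

text \<open>A complex multiple of a real vector.\<close>

definition cscale :: "complex \<Rightarrow> real^'n \<Rightarrow> complex^'n" where
  "cscale c v = (\<chi> i. c * complex_of_real (v $ i))"

section \<open>Local geometry relative to the evaluation point\<close>

text \<open>In the following, \<open>p\<close> is the evaluation point and \<open>q\<close> the surface point.\<close>

definition radius :: "real^3 \<Rightarrow> real^3 \<Rightarrow> real" where
  "radius p q = norm (q - p)"

definition height :: "(real \<times> real \<Rightarrow> real^3) \<Rightarrow> real^3 \<Rightarrow> real^3 \<Rightarrow> real" where
  "height X p q = unit_normal X q \<bullet> (p - q)"

definition rho_vec :: "(real \<times> real \<Rightarrow> real^3) \<Rightarrow> real^3 \<Rightarrow> real^3 \<Rightarrow> real^3" where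
  "rho_vec X p q = q - p + height X p q *\<^sub>R unit_normal X q"

definition rho :: "(real \<times> real \<Rightarrow> real^3) \<Rightarrow> real^3 \<Rightarrow> real^3 \<Rightarrow> real" where
  "rho X p q = norm (rho_vec X p q)"

definition rho_hat :: "(real \<times> real \<Rightarrow> real^3) \<Rightarrow> real^3 \<Rightarrow> real^3 \<Rightarrow> real^3" where
  "rho_hat X p q = rho_vec X p q /\<^sub>R rho X p q"

definition rho_tilde :: "(real \<times> real \<Rightarrow> real^3) \<Rightarrow> real^3 \<Rightarrow> real^3 \<Rightarrow> real^3" where
  "rho_tilde X p q = cross3 (unit_normal X q) (rho_hat X p q)"

section \<open>Laplace kernel\<close>

definition G_L :: "real^3 \<Rightarrow> real^3 \<Rightarrow> real" where
  "G_L p q = 1 / (4 * pi * radius p q)"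

definition f_L :: "(real \<times> real \<Rightarrow> real^3) \<Rightarrow> real^3 \<Rightarrow> real^3 \<Rightarrow> real^3" where
  "f_L X p q = (rho X p q / (4 * pi * (radius p q + height X p q))) *\<^sub>R rho_tilde X p q"

definition C_L :: "(real \<times> real \<Rightarrow> real^3) \<Rightarrow> real^3 \<Rightarrow> real^3 \<Rightarrow> real" where
  "C_L X p q = height X p q / (radius p q + height X p q)"

definition D_L :: "(real \<times> real \<Rightarrow> real^3) \<Rightarrow> real^3 \<Rightarrow> real^3 \<Rightarrow> real" where
  "D_L X p q = radius p q / (radius p q + height X p q)"

definition f_L' :: "(real \<times> real \<Rightarrow> real^3) \<Rightarrow> real^3 \<Rightarrow> real^3 \<Rightarrow> real^3" where
  "f_L' X p q = f_L X p q /\<^sub>R radius p q"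

definition C_L' :: "(real \<times> real \<Rightarrow> real^3) \<Rightarrow> real^3 \<Rightarrow> real^3 \<Rightarrow> real" where
  "C_L' X p q = C_L X p q / radius p q"

definition D_L' :: "(real \<times> real \<Rightarrow> real^3) \<Rightarrow> real^3 \<Rightarrow> real^3 \<Rightarrow> real" where
  "D_L' X p q = D_L X p q / radius p q"

section \<open>Helmholtz kernel\<close>

definition G_H :: "complex \<Rightarrow> real^3 \<Rightarrow> real^3 \<Rightarrow> complex" where
  "G_H k p q = (let r = complex_of_real (radius p q) in
     exp (\<i> * k * r) / (4 * complex_of_real pi * r))"

definition f_H :: "complex \<Rightarrow> (real \<times> real \<Rightarrow> real^3) \<Rightarrow> real^3 \<Rightarrow> real^3 \<Rightarrow> complex^3" where
  "f_H k X p q =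
     (let r = complex_of_real (radius p q); h = complex_of_real (height X p q);
          \<rho> = complex_of_real (rho X p q)
      in cscale ((exp (\<i> * k * r) - exp (\<i> * k * h)) / (4 * complex_of_real pi * \<i> * k * \<rho>))
           (rho_tilde X p q))"

definition C_H :: "complex \<Rightarrow> (real \<times> real \<Rightarrow> real^3) \<Rightarrow> real^3 \<Rightarrow> real^3 \<Rightarrow> complex" where
  "C_H k X p q =
     (let r = complex_of_real (radius p q); h = complex_of_real (height X p q);
          \<rho> = complex_of_real (rho X p q)
      in h * (exp (\<i> * k * r) - exp (\<i> * k * h)) / (\<i> * k * \<rho>\<^sup>2))"

definition D_H :: "complex \<Rightarrow> (real \<times> real \<Rightarrow> real^3) \<Rightarrow> real^3 \<Rightarrow> real^3 \<Rightarrow> complex" where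
  "D_H k X p q =
     (let r = complex_of_real (radius p q); h = complex_of_real (height X p q);
          \<rho> = complex_of_real (rho X p q)
      in exp (\<i> * k * h) - h * (exp (\<i> * k * r) - exp (\<i> * k * h)) / (\<i> * k * \<rho>\<^sup>2))"

definition f_H' :: "complex \<Rightarrow> (real \<times> real \<Rightarrow> real^3) \<Rightarrow> real^3 \<Rightarrow> real^3 \<Rightarrow> complex^3" where
  "f_H' k X p q =
     (let r = complex_of_real (radius p q); h = complex_of_real (height X p q);
          \<rho> = complex_of_real (rho X p q)
      in cscale ((r * exp (\<i> * k * h) - h * exp (\<i> * k * r)) / (4 * complex_of_real pi * r * \<rho>))
           (rho_tilde X p q))"

definition C_H' :: "complex \<Rightarrow> (real \<times> real \<Rightarrow> real^3) \<Rightarrow> real^3 \<Rightarrow> real^3 \<Rightarrow> complex" where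
  "C_H' k X p q =
     (let r = complex_of_real (radius p q); h = complex_of_real (height X p q);
          \<rho> = complex_of_real (rho X p q)
      in h * (r * exp (\<i> * k * h) - h * exp (\<i> * k * r)) / (r * \<rho>\<^sup>2))"

definition D_H' :: "complex \<Rightarrow> (real \<times> real \<Rightarrow> real^3) \<Rightarrow> real^3 \<Rightarrow> real^3 \<Rightarrow> complex" where
  "D_H' k X p q =
     (let r = complex_of_real (radius p q); h = complex_of_real (height X p q);
          \<rho> = complex_of_real (rho X p q)
      in (r * exp (\<i> * k * r) - h * exp (\<i> * k * h)) / \<rho>\<^sup>2 - \<i> * k * exp (\<i> * k * h))"

end

theory Submission
  imports Defs
begin

text \<open>All four fields have the form \<open>\<phi>(r, h) (n \<times> R)\<close> with \<open>R = q - p\<close>, because \<open>\<rho>\<close> times the unit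
  vector \<open>n \<times> \<rho>/|\<rho>|\<close> is \<open>n \<times> R\<close> and \<open>\<rho>\<^sup>2 = r\<^sup>2 - h\<^sup>2\<close>. In the orthonormal tangent frame given by \<open>\<rho>/|\<rho>|\<close>
  and \<open>n \<times> \<rho>/|\<rho>|\<close>, with normal curvatures \<open>\<kappa>\<close> and \<open>\<kappa>'\<close>, the radius and the height have the derivatives
  \<open>\<rho>/r\<close> and \<open>\<rho> \<kappa>\<close> in the first direction, and the trace of \<open>dn\<close> is \<open>- (\<kappa> + \<kappa>')\<close>. Hence the surface curl of
  such a field is \<open>(2 - h (\<kappa> + \<kappa>')) \<phi> + (\<rho>\<^sup>2/r) \<partial>\<phi>/\<partial>r + \<rho>\<^sup>2 \<kappa> \<partial>\<phi>/\<partial>h\<close>, and each of the four identities is this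
  formula for one function \<open>\<phi>\<close>.\<close>

section \<open>Symmetry of second derivatives\<close>

lemma has_real_derivative_along_line:
  fixes f :: "'a::real_normed_vector \<Rightarrow> real"
  assumes "(f has_derivative f') (at (w + s *\<^sub>R a))"
  shows "((\<lambda>s. f (w + s *\<^sub>R a)) has_real_derivative f' a) (at s)"
proof -
  interpret f': bounded_linear f' using assms by (rule has_derivative_bounded_linear)
  have "((\<lambda>s. w + s *\<^sub>R a) has_derivative (\<lambda>s. s *\<^sub>R a)) (at s)"
    by (auto intro!: derivative_eq_intros)
  moreover have "(*) (f' a) = (\<lambda>s. f' (s *\<^sub>R a))"
    by (simp add: fun_eq_iff f'.scaleR mult.commute)
  ultimately show ?thesis
    using has_derivative_compose[of "\<lambda>s. w + s *\<^sub>R a" _ s UNIV f f'] assms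
    by (simp add: has_field_derivative_def)
qed

text \<open>Schwarz's argument: the second difference over a parallelogram is the change, along
  \<open>a\<close>, of the increment along \<open>b\<close>. The mean value theorem in direction
  \<open>a\<close> brings in \<open>g'\<close>, and a second one in direction \<open>b\<close>
  brings in \<open>g''\<close>.\<close>

lemma mixed_difference_mean_value:
  fixes g :: "'a::real_normed_vector \<Rightarrow> real"
  assumes "0 < \<delta>"
    and U: "\<And>s t. \<lbrakk>0 \<le> s; s \<le> \<delta>; 0 \<le> t; t \<le> \<delta>\<rbrakk> \<Longrightarrow> w + s *\<^sub>R a + t *\<^sub>R b \<in> U"
    and g: "\<And>z. z \<in> U \<Longrightarrow> (g has_derivative g' z) (at z)"
    and g': "\<And>z. z \<in> U \<Longrightarrow> ((\<lambda>y. g' y a) has_derivative g'' z) (at z)"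
  obtains \<xi> \<eta> where "0 < \<xi>" "\<xi> < \<delta>" "0 < \<eta>" "\<eta> < \<delta>"
    "g (w + \<delta> *\<^sub>R a + \<delta> *\<^sub>R b) - g (w + \<delta> *\<^sub>R a) - g (w + \<delta> *\<^sub>R b) + g w
      = \<delta>\<^sup>2 * g'' (w + \<xi> *\<^sub>R a + \<eta> *\<^sub>R b) b"
proof -
  \<comment> \<open>\<open>?\<phi> \<delta> - ?\<phi> 0\<close> is the second difference.\<close>
  let ?\<phi> = "\<lambda>s. g (w + \<delta> *\<^sub>R b + s *\<^sub>R a) - g (w + s *\<^sub>R a)"
  have "\<exists>\<xi>>0. \<xi> < \<delta> \<and> ?\<phi> \<delta> - ?\<phi> 0
      = (\<delta> - 0) * (g' (w + \<delta> *\<^sub>R b + \<xi> *\<^sub>R a) a - g' (w + \<xi> *\<^sub>R a) a)"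
  proof (rule MVT2[OF \<open>0 < \<delta>\<close>])
    fix s assume "0 \<le> s" "s \<le> \<delta>"
    then show "(?\<phi> has_real_derivative (g' (w + \<delta> *\<^sub>R b + s *\<^sub>R a) a - g' (w + s *\<^sub>R a) a)) (at s)"
      using U[of s \<delta>] U[of s 0] \<open>0 < \<delta>\<close>
      by (intro DERIV_diff has_real_derivative_along_line g) (auto simp: algebra_simps)
  qed
  then obtain \<xi> where \<xi>: "0 < \<xi>" "\<xi> < \<delta>" "?\<phi> \<delta> - ?\<phi> 0
      = \<delta> * (g' (w + \<delta> *\<^sub>R b + \<xi> *\<^sub>R a) a - g' (w + \<xi> *\<^sub>R a) a)"
    by auto
  let ?\<psi> = "\<lambda>t. g' (w + \<xi> *\<^sub>R a + t *\<^sub>R b) a"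
  have "\<exists>\<eta>>0. \<eta> < \<delta> \<and> ?\<psi> \<delta> - ?\<psi> 0 = (\<delta> - 0) * g'' (w + \<xi> *\<^sub>R a + \<eta> *\<^sub>R b) b"
  proof (rule MVT2[OF \<open>0 < \<delta>\<close>])
    fix t assume "0 \<le> t" "t \<le> \<delta>"
    then show "(?\<psi> has_real_derivative g'' (w + \<xi> *\<^sub>R a + t *\<^sub>R b) b) (at t)"
      using U \<xi> by (intro has_real_derivative_along_line[where f = "\<lambda>y. g' y a"] g') auto
  qed
  then obtain \<eta> where \<eta>: "0 < \<eta>" "\<eta> < \<delta>" "?\<psi> \<delta> - ?\<psi> 0 = \<delta> * g'' (w + \<xi> *\<^sub>R a + \<eta> *\<^sub>R b) b"
    by auto
  have "g (w + \<delta> *\<^sub>R a + \<delta> *\<^sub>R b) - g (w + \<delta> *\<^sub>R a) - g (w + \<delta> *\<^sub>R b) + g w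
      = \<delta>\<^sup>2 * g'' (w + \<xi> *\<^sub>R a + \<eta> *\<^sub>R b) b"
    using \<xi>(3) \<eta>(3) by (simp add: algebra_simps power2_eq_square)
  with \<xi> \<eta> show ?thesis using that by blast
qed

text \<open>The second difference is unchanged when \<open>a\<close> and \<open>b\<close> are
  exchanged, so on every small parallelogram some value of one mixed derivative equals some value of
  the other. Continuity at \<open>w\<close> carries this equality to the limit.\<close>

lemma second_derivative_symmetric_real:
  fixes g :: "'a::real_normed_vector \<Rightarrow> real"
  assumes "open U" "w \<in> U"
    and g: "\<And>z. z \<in> U \<Longrightarrow> (g has_derivative g' z) (at z)"
    and ga: "\<And>z. z \<in> U \<Longrightarrow> ((\<lambda>y. g' y a) has_derivative ga z) (at z)"
    and gb: "\<And>z. z \<in> U \<Longrightarrow> ((\<lambda>y. g' y b) has_derivative gb z) (at z)"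
    and cont: "continuous_on U (\<lambda>z. ga z b)" "continuous_on U (\<lambda>z. gb z a)"
  shows "ga w b = gb w a"
proof (rule ccontr)
  assume "ga w b \<noteq> gb w a"
  \<comment> \<open>Half the supposed gap: a common value within \<open>e\<close> of both mixed
    derivatives at \<open>w\<close> would put them less than \<open>2 * e\<close> apart.\<close>
  define e where "e = \<bar>ga w b - gb w a\<bar> / 2"
  have "0 < e" using \<open>ga w b \<noteq> gb w a\<close> by (simp add: e_def)
  let ?T = "\<lambda>st. w + fst st *\<^sub>R a + snd st *\<^sub>R b"
  have T: "(?T \<longlongrightarrow> w) (at (0, 0))"
    by (auto intro!: tendsto_eq_intros)
  have "isCont (\<lambda>z. ga z b) w" "isCont (\<lambda>z. gb z a) w"
    using cont assms(1,2) by (auto simp: continuous_on_eq_continuous_at)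
  then have "((\<lambda>st. ga (?T st) b) \<longlongrightarrow> ga w b) (at (0, 0))" "((\<lambda>st. gb (?T st) a) \<longlongrightarrow> gb w a) (at (0, 0))"
    using T by (auto intro: isCont_tendsto_compose)
  then have "\<forall>\<^sub>F st in at (0, 0). dist (ga (?T st) b) (ga w b) < e"
    "\<forall>\<^sub>F st in at (0, 0). dist (gb (?T st) a) (gb w a) < e"
    using \<open>0 < e\<close> by (auto dest: tendstoD)
  moreover have "\<forall>\<^sub>F st in at (0, 0). ?T st \<in> U"
    using topological_tendstoD[OF T assms(1,2)] .
  ultimately have "\<forall>\<^sub>F st in at (0, 0). ?T st \<in> U
      \<and> dist (ga (?T st) b) (ga w b) < e \<and> dist (gb (?T st) a) (gb w a) < e"
    by eventually_elim auto
  then obtain d where "d > 0" and d: "\<And>s t. dist (s, t) (0, 0) < d \<Longrightarrow> (s, t) \<noteq> (0, 0) \<Longrightarrow> ?T (s, t) \<in> U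
      \<and> dist (ga (?T (s, t)) b) (ga w b) < e \<and> dist (gb (?T (s, t)) a) (gb w a) < e"
    by (auto simp: eventually_at)
  \<comment> \<open>For \<open>s\<close> and \<open>t\<close> in \<open>[0, d / 3]\<close> the
    distance to the origin is at most \<open>s + t\<close>, hence below \<open>d\<close>.\<close>
  define \<delta> where "\<delta> = d / 3"
  have "0 < \<delta>" using \<open>0 < d\<close> by (simp add: \<delta>_def)
  have near: "dist (s, t) (0, 0) < d" if "0 \<le> s" "s \<le> \<delta>" "0 \<le> t" "t \<le> \<delta>" for s t :: real
    using that \<open>0 < d\<close> sqrt_sum_squares_le_sum_abs[of s t] by (simp add: dist_Pair_Pair dist_real_def \<delta>_def)
  \<comment> \<open>The origin is treated separately because the neighbourhood obtained above is
    punctured.\<close>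
  have inU: "w + s *\<^sub>R a + t *\<^sub>R b \<in> U" if "0 \<le> s" "s \<le> \<delta>" "0 \<le> t" "t \<le> \<delta>" for s t
    using d[OF near[OF that]] \<open>w \<in> U\<close> by (cases "(s, t) = (0, 0)") auto
  obtain \<xi> \<eta> where 1: "0 < \<xi>" "\<xi> < \<delta>" "0 < \<eta>" "\<eta> < \<delta>"
    "g (w + \<delta> *\<^sub>R a + \<delta> *\<^sub>R b) - g (w + \<delta> *\<^sub>R a) - g (w + \<delta> *\<^sub>R b) + g w
      = \<delta>\<^sup>2 * ga (w + \<xi> *\<^sub>R a + \<eta> *\<^sub>R b) b"
    using mixed_difference_mean_value[OF \<open>0 < \<delta>\<close> inU g ga] by blast
  obtain \<xi>' \<eta>' where 2: "0 < \<xi>'" "\<xi>' < \<delta>" "0 < \<eta>'" "\<eta>' < \<delta>"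
    "g (w + \<delta> *\<^sub>R b + \<delta> *\<^sub>R a) - g (w + \<delta> *\<^sub>R b) - g (w + \<delta> *\<^sub>R a) + g w
      = \<delta>\<^sup>2 * gb (w + \<xi>' *\<^sub>R b + \<eta>' *\<^sub>R a) a"
  \<comment> \<open>Same second difference, with the two directions in the opposite order.\<close>
  proof (rule mixed_difference_mean_value[OF \<open>0 < \<delta>\<close>, of w b a U g g' gb])
    fix s t assume "0 \<le> s" "s \<le> \<delta>" "0 \<le> t" "t \<le> \<delta>"
    then show "w + s *\<^sub>R b + t *\<^sub>R a \<in> U"
      using inU[of t s] by (simp add: add_ac)
  qed (use g gb in auto)
  have "w + \<delta> *\<^sub>R b + \<delta> *\<^sub>R a = w + \<delta> *\<^sub>R a + \<delta> *\<^sub>R b"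
    "w + \<xi>' *\<^sub>R b + \<eta>' *\<^sub>R a = w + \<eta>' *\<^sub>R a + \<xi>' *\<^sub>R b"
    by simp_all
  from 1(5) 2(5)[unfolded this] have "\<delta>\<^sup>2 * ga (w + \<xi> *\<^sub>R a + \<eta> *\<^sub>R b) b = \<delta>\<^sup>2 * gb (w + \<eta>' *\<^sub>R a + \<xi>' *\<^sub>R b) a"
    by linarith
  then have "ga (w + \<xi> *\<^sub>R a + \<eta> *\<^sub>R b) b = gb (w + \<eta>' *\<^sub>R a + \<xi>' *\<^sub>R b) a"
    using \<open>0 < \<delta>\<close> by simp
  moreover have "dist (ga (w + \<xi> *\<^sub>R a + \<eta> *\<^sub>R b) b) (ga w b) < e"
    using d[OF near[of \<xi> \<eta>]] 1 by auto
  moreover have "dist (gb (w + \<eta>' *\<^sub>R a + \<xi>' *\<^sub>R b) a) (gb w a) < e"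
    using d[OF near[of \<eta>' \<xi>']] 2 by auto
  ultimately show False
    using dist_triangle3[of "ga w b" "gb w a" "ga (w + \<xi> *\<^sub>R a + \<eta> *\<^sub>R b) b"]
    by (simp add: e_def dist_real_def[of "ga w b" "gb w a"])
qed

text \<open>The mean value theorem concerns real functions, so the vector case is tested against
  every \<open>c\<close> through the inner product.\<close>

lemma second_derivative_symmetric:
  fixes g :: "'a::euclidean_space \<Rightarrow> 'b::real_inner"
  assumes "open U" "w \<in> U" "Ck_on 2 g U"
  shows "frechet_derivative (\<lambda>x. frechet_derivative g (at x) a) (at w) b
       = frechet_derivative (\<lambda>x. frechet_derivative g (at x) b) (at w) a"
proof -
  let ?D = "\<lambda>z. frechet_derivative g (at z)"
  have 1: "(g has_derivative ?D z) (at z)" if "z \<in> U" for z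
    using assms(3) that by (simp add: numeral_2_eq_2 frechet_derivative_works[symmetric])
  have 2: "((\<lambda>y. ?D y d) has_derivative frechet_derivative (\<lambda>y. ?D y d) (at z)) (at z)" if "z \<in> U" for z d
    using assms(3) that by (simp add: numeral_2_eq_2 frechet_derivative_works[symmetric])
  have 3: "continuous_on U (\<lambda>z. frechet_derivative (\<lambda>y. ?D y d) (at z) d')" for d d'
    using assms(3) by (simp add: numeral_2_eq_2)
  have "c \<bullet> frechet_derivative (\<lambda>x. ?D x a) (at w) b = c \<bullet> frechet_derivative (\<lambda>x. ?D x b) (at w) a" for c
    by (rule second_derivative_symmetric_real[OF assms(1,2), of "\<lambda>z. c \<bullet> g z" "\<lambda>z d. c \<bullet> ?D z d"
          a "\<lambda>z d. c \<bullet> frechet_derivative (\<lambda>y. ?D y a) (at z) d" b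
          "\<lambda>z d. c \<bullet> frechet_derivative (\<lambda>y. ?D y b) (at z) d"])
      (auto intro!: has_derivative_inner_right 1 2 3 continuous_on_inner)
  then show ?thesis
    by (metis inner_commute vector_eq_rdot)
qed

section \<open>Derivatives relative to the reference triangle\<close>

text \<open>By convexity the segment from \<open>w\<close> to any \<open>y\<close> stays in the
  triangle, and one-variable uniqueness along it fixes the derivative at \<open>y - w\<close>. Such
  directions span the plane even when \<open>w\<close> is on an edge or at a corner.\<close>

lemma has_derivative_unique_triangle:
  fixes f :: "real \<times> real \<Rightarrow> 'b::real_normed_vector"
  assumes "w \<in> ref_triangle"
    and f': "(f has_derivative f') (at w within ref_triangle)"
    and f'': "(f has_derivative f'') (at w within ref_triangle)"
  shows "f' = f''"
proof -
  interpret f': bounded_linear f' using f' by (rule has_derivative_bounded_linear)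
  interpret f'': bounded_linear f'' using f'' by (rule has_derivative_bounded_linear)
  have segment: "f' (y - w) = f'' (y - w)" if "y \<in> ref_triangle" for y
  proof -
    let ?l = "\<lambda>t. w + t *\<^sub>R (y - w)"
    have l: "(?l has_derivative (\<lambda>t. t *\<^sub>R (y - w))) (at 0 within {0..1})"
      by (auto intro!: derivative_eq_intros)
    have "convex ref_triangle"
    proof -
      have "ref_triangle = {z. (-1, 0) \<bullet> z \<le> 0} \<inter> {z. (0, -1) \<bullet> z \<le> 0} \<inter> {z. (1, 1) \<bullet> z \<le> (1::real)}"
        by (auto simp: ref_triangle_def)
      show ?thesis
        unfolding \<open>ref_triangle = _\<close> by (intro convex_Int convex_halfspace_le)
    qed
    have sub: "?l ` {0..1} \<subseteq> ref_triangle"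
    proof (rule image_subsetI)
      fix t :: real assume "t \<in> {0..1}"
      with convexD_alt[OF \<open>convex ref_triangle\<close> assms(1) that, of t]
      show "?l t \<in> ref_triangle" by (simp add: algebra_simps)
    qed
    have "((\<lambda>t. f (?l t)) has_derivative (\<lambda>t. F (t *\<^sub>R (y - w)))) (at 0 within {0..1})"
      if "(f has_derivative F) (at w within ref_triangle)" for F
      using has_derivative_in_compose[OF l] has_derivative_subset[OF that sub] by simp
    from this[OF f'] this[OF f'']
    have "((\<lambda>t. f (?l t)) has_vector_derivative f' (y - w)) (at 0 within cbox 0 1)"
      "((\<lambda>t. f (?l t)) has_vector_derivative f'' (y - w)) (at 0 within cbox 0 1)"
      by (auto simp: has_vector_derivative_def f'.scaleR f''.scaleR)
    then show ?thesis
      by (rule vector_derivative_unique_within_closed_interval[rotated 2]) auto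
  qed
  \<comment> \<open>Subtracting two segment directions eliminates \<open>w\<close>; differences of
    the three vertices then yield the basis vectors.\<close>
  have diff: "f' (y - z) = f'' (y - z)" if "y \<in> ref_triangle" "z \<in> ref_triangle" for y z
    using segment[OF that(1)] segment[OF that(2)]
    by (metis (no_types, lifting) f'.diff f''.diff diff_diff_eq2 diff_add_cancel)
  have "f' (1, 0) = f'' (1, 0)" "f' (0, 1) = f'' (0, 1)"
    using diff[of "(1, 0)" "(0, 0)"] diff[of "(0, 1)" "(0, 0)"] by (simp_all add: ref_triangle_def)
  show ?thesis
  proof
    fix d :: "real \<times> real"
    have d: "d = fst d *\<^sub>R (1, 0) + snd d *\<^sub>R (0, 1)" by (simp add: prod_eq_iff)
    show "f' d = f'' d"
      by (subst (1 2) d) (simp only: f'.add f''.add f'.scaleR f''.scaleR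
        \<open>f' (1, 0) = f'' (1, 0)\<close> \<open>f' (0, 1) = f'' (0, 1)\<close>)
  qed
qed

text \<open>Turns an identity that holds on the whole element, such as
  \<open>n \<bullet> n = 1\<close>, into a linear relation between derivatives at one point.\<close>

lemma has_derivative_constant_triangle:
  fixes f :: "real \<times> real \<Rightarrow> 'b::real_normed_vector"
  assumes "w \<in> ref_triangle" "(f has_derivative f') (at w within ref_triangle)"
    and "\<And>z. z \<in> ref_triangle \<Longrightarrow> f z = c"
  shows "f' d = 0"
proof -
  have "((\<lambda>_. c) has_derivative f') (at w within ref_triangle)"
    using has_derivative_transform[OF assms(1) _ assms(2), of "\<lambda>_. c"] assms(3) by simp
  then show ?thesis
    using has_derivative_unique_triangle[OF assms(1) _ has_derivative_const] by metis
qed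

text \<open>Derivatives computed by product and chain rules for the pullback to the triangle
  transfer to \<open>surf_deriv\<close>: injectivity recovers the parameter \<open>w\<close>, and
  uniqueness identifies the derivative.\<close>

lemma surf_deriv_eq:
  assumes "inj_on X ref_triangle" "w \<in> ref_triangle"
    and "((\<lambda>w. f (X w)) has_derivative F) (at w within ref_triangle)"
  shows "surf_deriv X d f (X w) = F d"
proof -
  have "((\<lambda>w. f (X w)) has_derivative frechet_derivative (\<lambda>w. f (X w)) (at w within ref_triangle))
      (at w within ref_triangle)"
    using assms(3) differentiableI frechet_derivative_works by blast
  then have "frechet_derivative (\<lambda>w. f (X w)) (at w within ref_triangle) = F"
    using assms(2,3) has_derivative_unique_triangle by blast
  then show ?thesis
    using assms(1,2) by (simp add: surf_deriv_def)
qed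

lemma has_derivative_surf_deriv:
  assumes "inj_on X ref_triangle" "w \<in> ref_triangle"
    and "(\<lambda>w. f (X w)) differentiable (at w within ref_triangle)"
  shows "((\<lambda>w. f (X w)) has_derivative (\<lambda>d. surf_deriv X d f (X w))) (at w within ref_triangle)"
  using assms by (simp add: surf_deriv_def frechet_derivative_works[symmetric])

lemma surf_deriv_smooth_extension:
  assumes "inj_on X ref_triangle" "w \<in> ref_triangle"
    and "\<And>z. z \<in> ref_triangle \<Longrightarrow> f (X z) = g z"
    and "(g has_derivative g') (at w)"
  shows "((\<lambda>z. f (X z)) has_derivative g') (at w within ref_triangle)"
    and "surf_deriv X d f (X w) = g' d"
proof -
  show "((\<lambda>z. f (X z)) has_derivative g') (at w within ref_triangle)"
    by (rule has_derivative_transform[OF assms(2,3) has_derivative_at_withinI[OF assms(4)]])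
  then show "surf_deriv X d f (X w) = g' d"
    using assms(1,2) surf_deriv_eq by blast
qed

text \<open>The smooth extension \<open>g\<close> supplies all regularity: the tangents are its
  partial derivatives, which can be differentiated once more, and its mixed partials
  commute.\<close>

lemma boundary_element_derivatives:
  assumes "boundary_element S X" "w \<in> ref_triangle"
  shows "(X has_derivative (\<lambda>d. surf_deriv X d (\<lambda>q. q) (X w))) (at w within ref_triangle)"
    and "((\<lambda>w. tan_u X (X w)) has_derivative (\<lambda>d. surf_deriv X d (tan_u X) (X w))) (at w within ref_triangle)"
    and "((\<lambda>w. tan_v X (X w)) has_derivative (\<lambda>d. surf_deriv X d (tan_v X) (X w))) (at w within ref_triangle)"
    and "du X (tan_v X) (X w) = dv X (tan_u X) (X w)"
proof -
  have inj: "inj_on X ref_triangle" and "smooth_on ref_triangle X"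
    using assms by (auto simp: boundary_element_def)
  then obtain U g where U: "open U" "ref_triangle \<subseteq> U" "\<And>k. Ck_on k g U"
    and gX: "\<And>z. z \<in> ref_triangle \<Longrightarrow> X z = g z"
    unfolding smooth_on_def by metis
  let ?D = "\<lambda>z. frechet_derivative g (at z)"
  have C2: "Ck_on (Suc (Suc 0)) g U" by (rule U(3))
  have D: "(g has_derivative ?D z) (at z)" if "z \<in> ref_triangle" for z
    using C2 that U(2) by (auto simp: frechet_derivative_works[symmetric])
  have D2: "((\<lambda>y. ?D y d) has_derivative frechet_derivative (\<lambda>y. ?D y d) (at z)) (at z)"
    if "z \<in> ref_triangle" for z d
    using C2 that U(2) unfolding Ck_on.simps frechet_derivative_works[symmetric] by blast
  have X: "(X has_derivative ?D z) (at z within ref_triangle)"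
      "surf_deriv X d (\<lambda>q. q) (X z) = ?D z d" if "z \<in> ref_triangle" for z d
    using surf_deriv_smooth_extension[of X z "\<lambda>q. q" g "?D z"] inj gX D that by auto
  \<comment> \<open>The identification with partials of \<open>g\<close> must hold at every
    \<open>z\<close> of the triangle, since the tangent fields are differentiated next.\<close>
  have Du: "tan_u X (X z) = ?D z (1, 0)" and Dv: "tan_v X (X z) = ?D z (0, 1)" if "z \<in> ref_triangle" for z
    using X(2)[OF that] by (simp_all add: tan_u_def tan_v_def)
  note Xu = surf_deriv_smooth_extension[of X w "tan_u X" "\<lambda>z. ?D z (1, 0)", OF inj assms(2) Du D2[OF assms(2)]]
  note Xv = surf_deriv_smooth_extension[of X w "tan_v X" "\<lambda>z. ?D z (0, 1)", OF inj assms(2) Dv D2[OF assms(2)]]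
  show "(X has_derivative (\<lambda>d. surf_deriv X d (\<lambda>q. q) (X w))) (at w within ref_triangle)"
    using has_derivative_surf_deriv[OF inj assms(2), of "\<lambda>q. q"] X(1)[OF assms(2)]
    by (auto intro: differentiableI)
  show "((\<lambda>w. tan_u X (X w)) has_derivative (\<lambda>d. surf_deriv X d (tan_u X) (X w))) (at w within ref_triangle)"
    using has_derivative_surf_deriv[OF inj assms(2)] Xu(1) differentiableI by blast
  show "((\<lambda>w. tan_v X (X w)) has_derivative (\<lambda>d. surf_deriv X d (tan_v X) (X w))) (at w within ref_triangle)"
    using has_derivative_surf_deriv[OF inj assms(2)] Xv(1) differentiableI by blast
  show "du X (tan_v X) (X w) = dv X (tan_u X) (X w)"
    using Xu(2) Xv(2) second_derivative_symmetric[OF U(1) _ U(3), of w "(0, 1)" "(1, 0)"] U(2) assms(2)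
    by (auto simp: numeral_2_eq_2)
qed

section \<open>Derivatives of the scalar densities\<close>

lemma has_derivative_exp_of_real:
  fixes r :: "'b::real_normed_vector \<Rightarrow> real"
  assumes "(r has_derivative dr) (at w within T)"
  shows "((\<lambda>z. exp (c * complex_of_real (r z))) has_derivative (\<lambda>d. of_real (dr d) * (c * exp (c * r w))))
    (at w within T)"
proof -
  have "((\<lambda>z. c * complex_of_real (r z)) has_derivative (\<lambda>d. c * complex_of_real (dr d))) (at w within T)"
    by (intro has_derivative_mult_right has_derivative_of_real assms)
  from has_derivative_compose[OF this DERIV_exp[unfolded has_field_derivative_def]]
  show ?thesis by (simp add: mult_ac)
qed

text \<open>The factors of \<open>dr\<close> and \<open>dh\<close> are the partial derivatives of
  the density of \<open>f_L\<close> in radius and height, in the shape that the curl formula takes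
  as input.\<close>

lemma laplace_density_derivative:
  fixes r h :: "'b::real_normed_vector \<Rightarrow> real"
  assumes D: "(r has_derivative dr) (at w within T)" "(h has_derivative dh) (at w within T)"
    and nz: "r w + h w \<noteq> 0"
  shows "((\<lambda>z. 1 / (4 * pi * (r z + h z))) has_derivative
      (\<lambda>d. dr d *\<^sub>R (- 1 / (4 * pi * (r w + h w)\<^sup>2)) + dh d *\<^sub>R (- 1 / (4 * pi * (r w + h w)\<^sup>2))))
      (at w within T)"
proof -
  have "((\<lambda>z. 1 / (4 * pi * (r z + h z))) has_derivative
      (\<lambda>d. (0 * (4 * pi * (r w + h w)) - 1 * (4 * pi * (dr d + dh d))) / (4 * pi * (r w + h w) * (4 * pi * (r w + h w)))))
      (at w within T)"
    using nz by (intro has_derivative_divide' has_derivative_mult_right has_derivative_add has_derivative_const D) auto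
  then show ?thesis
    by (rule has_derivative_eq_rhs) (use nz in \<open>auto simp: fun_eq_iff divide_simps power2_eq_square, auto simp: algebra_simps\<close>)
qed

text \<open>The same for the density of \<open>f_L'\<close>; the numerator
  \<open>2 * r w + h w\<close> is the radial derivative of \<open>r * (r + h)\<close>.\<close>

lemma laplace_normal_density_derivative:
  fixes r h :: "'b::real_normed_vector \<Rightarrow> real"
  assumes D: "(r has_derivative dr) (at w within T)" "(h has_derivative dh) (at w within T)"
    and nz: "r w \<noteq> 0" "r w + h w \<noteq> 0"
  shows "((\<lambda>z. 1 / (4 * pi * r z * (r z + h z))) has_derivative
      (\<lambda>d. dr d *\<^sub>R (- (2 * r w + h w) / (4 * pi * (r w)\<^sup>2 * (r w + h w)\<^sup>2))
         + dh d *\<^sub>R (- 1 / (4 * pi * r w * (r w + h w)\<^sup>2))))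
      (at w within T)"
proof -
  have "((\<lambda>z. 1 / (4 * pi * (r z * (r z + h z)))) has_derivative
      (\<lambda>d. (0 * (4 * pi * (r w * (r w + h w))) - 1 * (4 * pi * (r w * (dr d + dh d) + dr d * (r w + h w))))
        / (4 * pi * (r w * (r w + h w)) * (4 * pi * (r w * (r w + h w))))))
      (at w within T)"
    using nz by (intro has_derivative_divide' has_derivative_mult_right has_derivative_mult has_derivative_add
        has_derivative_const D) auto
  then have "((\<lambda>z. 1 / (4 * pi * (r z * (r z + h z)))) has_derivative
      (\<lambda>d. dr d *\<^sub>R (- (2 * r w + h w) / (4 * pi * (r w)\<^sup>2 * (r w + h w)\<^sup>2))
         + dh d *\<^sub>R (- 1 / (4 * pi * r w * (r w + h w)\<^sup>2))))
      (at w within T)"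
    by (rule has_derivative_eq_rhs)
      (use nz in \<open>auto simp: fun_eq_iff divide_simps power2_eq_square, auto simp: algebra_simps\<close>)
  then show ?thesis by (simp add: mult.assoc)
qed

text \<open>Density of \<open>f_H\<close>, with \<rho> squared written as
  \<open>r\<^sup>2 - h\<^sup>2\<close> so that radius and height are the only variables.\<close>

lemma helmholtz_density_derivative:
  fixes r h :: "'b::real_normed_vector \<Rightarrow> real" and w and E H m \<kappa> :: complex
  assumes D: "(r has_derivative dr) (at w within T)" "(h has_derivative dh) (at w within T)"
    and nz: "\<kappa> \<noteq> 0" "(r w)\<^sup>2 \<noteq> (h w)\<^sup>2"
  defines "E \<equiv> exp (\<i> * \<kappa> * r w)" and "H \<equiv> exp (\<i> * \<kappa> * h w)" and "m \<equiv> complex_of_real ((r w)\<^sup>2 - (h w)\<^sup>2)"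
  shows "((\<lambda>z. (exp (\<i> * \<kappa> * r z) - exp (\<i> * \<kappa> * h z)) / (4 * pi * \<i> * \<kappa> * complex_of_real ((r z)\<^sup>2 - (h z)\<^sup>2)))
    has_derivative (\<lambda>d. dr d *\<^sub>R ((\<i> * \<kappa> * E / m - 2 * complex_of_real (r w) * (E - H) / m\<^sup>2) / (4 * pi * \<i> * \<kappa>))
      + dh d *\<^sub>R ((2 * complex_of_real (h w) * (E - H) / m\<^sup>2 - \<i> * \<kappa> * H / m) / (4 * pi * \<i> * \<kappa>)))) (at w within T)"
proof -
  have m: "m \<noteq> 0" using nz(2) unfolding m_def of_real_eq_0_iff by simp
  have sq: "((\<lambda>z. (r z)\<^sup>2 - (h z)\<^sup>2) has_derivative (\<lambda>d. 2 * r w * dr d - 2 * h w * dh d)) (at w within T)"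
    by (auto intro!: derivative_eq_intros D)
  have "((\<lambda>z. (exp (\<i> * \<kappa> * r z) - exp (\<i> * \<kappa> * h z)) / (4 * pi * \<i> * \<kappa> * complex_of_real ((r z)\<^sup>2 - (h z)\<^sup>2)))
    has_derivative (\<lambda>d. ((of_real (dr d) * (\<i> * \<kappa> * E) - of_real (dh d) * (\<i> * \<kappa> * H)) * (4 * pi * \<i> * \<kappa> * m)
       - (E - H) * (4 * pi * \<i> * \<kappa> * of_real (2 * r w * dr d - 2 * h w * dh d)))
      / (4 * pi * \<i> * \<kappa> * m * (4 * pi * \<i> * \<kappa> * m)))) (at w within T)"
    unfolding E_def H_def m_def
    by (intro has_derivative_divide' has_derivative_mult_right has_derivative_diff
        has_derivative_exp_of_real has_derivative_of_real sq D)
      (use nz m in \<open>simp_all add: m_def[symmetric] del: of_real_diff of_real_power\<close>)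
  then show ?thesis
    by (rule has_derivative_eq_rhs)
      (use nz m in \<open>auto simp: fun_eq_iff divide_simps scaleR_conv_of_real power2_eq_square, auto simp: algebra_simps\<close>)
qed

text \<open>Density of \<open>f_H'\<close>. In the radial part the terms \<open>R * H * m\<close>
  from the numerator and from \<open>K * m\<close> cancel, which leaves only \<open>E\<close> beside
  \<open>K\<close>.\<close>

lemma helmholtz_normal_density_derivative:
  fixes r h :: "'b::real_normed_vector \<Rightarrow> real" and w and E H K m \<kappa> :: complex
  assumes D: "(r has_derivative dr) (at w within T)" "(h has_derivative dh) (at w within T)"
    and nz: "r w \<noteq> 0" "(r w)\<^sup>2 \<noteq> (h w)\<^sup>2"
  defines "E \<equiv> exp (\<i> * \<kappa> * r w)" and "H \<equiv> exp (\<i> * \<kappa> * h w)"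
    and "K \<equiv> r w * H - h w * E" and "m \<equiv> complex_of_real ((r w)\<^sup>2 - (h w)\<^sup>2)"
  shows "((\<lambda>z. (r z * exp (\<i> * \<kappa> * h z) - h z * exp (\<i> * \<kappa> * r z))
        / (4 * pi * complex_of_real (r z) * complex_of_real ((r z)\<^sup>2 - (h z)\<^sup>2)))
    has_derivative (\<lambda>d.
        dr d *\<^sub>R ((h w * E * (1 - \<i> * \<kappa> * r w) * m - 2 * (complex_of_real (r w))\<^sup>2 * K)
          / (4 * pi * (complex_of_real (r w))\<^sup>2 * m\<^sup>2))
      + dh d *\<^sub>R (((\<i> * \<kappa> * r w * H - E) * m + 2 * complex_of_real (h w) * K)
          / (4 * pi * complex_of_real (r w) * m\<^sup>2)))) (at w within T)"
    (is "(?\<phi> has_derivative ?D) _")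
proof -
  define R h' P where "R = complex_of_real (r w)" and "h' = complex_of_real (h w)" and "P = complex_of_real (4 * pi)"
  have m: "m \<noteq> 0" using nz(2) unfolding m_def of_real_eq_0_iff by simp
  have R: "R \<noteq> 0" and P: "P \<noteq> 0" using nz(1) by (simp_all add: R_def P_def)
  have K: "K = R * H - h' * E" by (simp add: K_def R_def h'_def)
  let ?N = "\<lambda>d. R * (of_real (dh d) * (\<i> * \<kappa> * H)) + of_real (dr d) * H
          - (h' * (of_real (dr d) * (\<i> * \<kappa> * E)) + of_real (dh d) * E)"
  let ?Q = "\<lambda>d. R * (2 * R * of_real (dr d) - 2 * h' * of_real (dh d)) + of_real (dr d) * m"
  have sq: "((\<lambda>z. (r z)\<^sup>2 - (h z)\<^sup>2) has_derivative (\<lambda>d. 2 * r w * dr d - 2 * h w * dh d)) (at w within T)"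
    by (auto intro!: derivative_eq_intros D)
  have "((\<lambda>z. complex_of_real ((r z)\<^sup>2 - (h z)\<^sup>2)) has_derivative
      (\<lambda>d. 2 * R * of_real (dr d) - 2 * h' * of_real (dh d))) (at w within T)"
    using has_derivative_of_real[OF sq] by (simp add: R_def h'_def)
  then have "((\<lambda>z. (complex_of_real (r z) * exp (\<i> * \<kappa> * h z) - complex_of_real (h z) * exp (\<i> * \<kappa> * r z))
        / (P * (complex_of_real (r z) * complex_of_real ((r z)\<^sup>2 - (h z)\<^sup>2))))
      has_derivative (\<lambda>d. (?N d * (P * (R * m)) - (R * H - h' * E) * (P * ?Q d)) / (P * (R * m) * (P * (R * m)))))
      (at w within T)"
    unfolding E_def H_def R_def h'_def m_def
    by (intro has_derivative_divide' has_derivative_mult_right has_derivative_mult has_derivative_diff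
        has_derivative_exp_of_real has_derivative_of_real D)
      (use R m P in \<open>simp_all add: m_def[symmetric] R_def[symmetric] del: of_real_diff of_real_power\<close>)
  moreover have "(?N d * (P * (R * m)) - (R * H - h' * E) * (P * ?Q d)) / (P * (R * m) * (P * (R * m))) = ?D d" for d
  proof -
    have "(?N d * (P * (R * m)) - (R * H - h' * E) * (P * ?Q d)) / (P * (R * m) * (P * (R * m)))
        = (P * (?N d * R * m - K * ?Q d)) / (P * (P * R\<^sup>2 * m\<^sup>2))"
      unfolding K by (simp add: algebra_simps power2_eq_square)
    also have "\<dots> = (?N d * R * m - K * ?Q d) / (P * R\<^sup>2 * m\<^sup>2)"
      using P by (rule nonzero_mult_divide_mult_cancel_left)
    also have "?N d * R * m - K * ?Q d
        = of_real (dr d) * (h' * E * (1 - \<i> * \<kappa> * R) * m - 2 * R\<^sup>2 * K)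
        + R * (of_real (dh d) * ((\<i> * \<kappa> * R * H - E) * m + 2 * h' * K))"
      unfolding K by (simp add: algebra_simps power2_eq_square)
    also have "\<dots> / (P * R\<^sup>2 * m\<^sup>2)
        = of_real (dr d) * ((h' * E * (1 - \<i> * \<kappa> * R) * m - 2 * R\<^sup>2 * K) / (P * R\<^sup>2 * m\<^sup>2))
        + (R * (of_real (dh d) * ((\<i> * \<kappa> * R * H - E) * m + 2 * h' * K))) / (R * (P * R * m\<^sup>2))"
      by (simp add: add_divide_distrib power2_eq_square mult_ac)
    also have "(R * (of_real (dh d) * ((\<i> * \<kappa> * R * H - E) * m + 2 * h' * K))) / (R * (P * R * m\<^sup>2))
        = of_real (dh d) * (((\<i> * \<kappa> * R * H - E) * m + 2 * h' * K) / (P * R * m\<^sup>2))"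
      using nonzero_mult_divide_mult_cancel_left[OF R] by simp
    finally show ?thesis
      by (simp add: R_def h'_def P_def scaleR_conv_of_real)
  qed
  ultimately show ?thesis
    by (simp add: P_def mult.assoc[symmetric] del: of_real_diff of_real_power)
qed

section \<open>Cross products\<close>

lemma bounded_bilinear_cross3: "bounded_bilinear cross3"
  using bilinear_conv_bounded_bilinear bilinear_cross by blast

text \<open>Cramer's rule in the plane of \<open>x\<close> and \<open>y\<close>: the general
  expansion has a further term along \<open>cross3 x y\<close>, which the assumption
  removes.\<close>

lemma cross3_expansion:
  fixes t x y :: "real^3"
  assumes "t \<bullet> cross3 x y = 0"
  shows "(norm (cross3 x y))\<^sup>2 *\<^sub>R t
    = (cross3 x y \<bullet> cross3 t y) *\<^sub>R x + (cross3 x y \<bullet> cross3 x t) *\<^sub>R y"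
proof -
  have "(cross3 x y \<bullet> cross3 x y) *\<^sub>R t
    = (cross3 x y \<bullet> cross3 t y) *\<^sub>R x + (cross3 x y \<bullet> cross3 x t) *\<^sub>R y + (t \<bullet> cross3 x y) *\<^sub>R cross3 x y"
    by (simp add: cross3_simps forall_3)
  with assms show ?thesis by (simp add: power2_norm_eq_inner)
qed

lemma cross3_cross3_normal:
  fixes n e :: "real^3"
  assumes "n \<bullet> n = 1" "n \<bullet> e = 0"
  shows "cross3 (cross3 n e) n = e"
proof -
  have "cross3 (cross3 n e) n = (n \<bullet> n) *\<^sub>R e - (n \<bullet> e) *\<^sub>R n"
    by (simp add: cross3_simps forall_3)
  with assms show ?thesis by simp
qed

text \<open>All three vectors lie in the plane orthogonal to \<open>n\<close>, so their determinant
  vanishes. The identity used expands \<open>n\<close> in the basis dual to \<open>x\<close>,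
  \<open>y\<close>, \<open>z\<close>.\<close>

lemma triple_product_coplanar:
  fixes n x y z :: "real^3"
  assumes "n \<bullet> n = 1" "n \<bullet> x = 0" "n \<bullet> y = 0" "n \<bullet> z = 0"
  shows "x \<bullet> cross3 y z = 0"
proof -
  have "(n \<bullet> n) * (x \<bullet> cross3 y z)
      = (n \<bullet> x) * (n \<bullet> cross3 y z) + (n \<bullet> y) * (n \<bullet> cross3 z x) + (n \<bullet> z) * (n \<bullet> cross3 x y)"
    by (simp add: cross3_simps forall_3)
  with assms show ?thesis by simp
qed

text \<open>Both sides are \<open>J\<close> times the trace of the tangential part of the linear map
  with \<open>x\<close> to \<open>x'\<close> and \<open>y\<close> to \<open>y'\<close>: on the left
  in the basis \<open>x\<close>, \<open>y\<close> through the area form, on the right in the frame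
  \<open>e\<close>, \<open>cross3 n e\<close>.\<close>

lemma trace_in_orthonormal_frame:
  fixes n e x y x' y' :: "real^3"
  assumes n: "n \<bullet> n = 1" and xy: "cross3 x y = J *\<^sub>R n"
    and e: "n \<bullet> e = 0" "e \<bullet> e = 1"
    and ea: "e = a *\<^sub>R x + b *\<^sub>R y" and ec: "cross3 n e = c *\<^sub>R x + d *\<^sub>R y"
  shows "n \<bullet> (cross3 x y' + cross3 x' y)
    = J * (e \<bullet> (a *\<^sub>R x' + b *\<^sub>R y') + cross3 n e \<bullet> (c *\<^sub>R x' + d *\<^sub>R y'))"
proof -
  \<comment> \<open>Inner products with the frame vectors become area forms, in which the frame can
    be expanded in \<open>x\<close> and \<open>y\<close>.\<close>
  have "e \<bullet> z = n \<bullet> cross3 z (cross3 n e)" for z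
  proof -
    have "n \<bullet> cross3 z (cross3 n e) = z \<bullet> cross3 (cross3 n e) n"
      by (simp add: cross3_simps)
    then show ?thesis
      using n e by (simp add: cross3_cross3_normal inner_commute)
  qed
  moreover have "cross3 n e \<bullet> z = n \<bullet> cross3 e z" for z
    by (simp add: cross3_simps)
  ultimately have "e \<bullet> (a *\<^sub>R x' + b *\<^sub>R y') + cross3 n e \<bullet> (c *\<^sub>R x' + d *\<^sub>R y')
    = n \<bullet> cross3 (a *\<^sub>R x' + b *\<^sub>R y') (c *\<^sub>R x + d *\<^sub>R y) + n \<bullet> cross3 (a *\<^sub>R x + b *\<^sub>R y) (c *\<^sub>R x' + d *\<^sub>R y')"
    using ea ec by metis
  also have "\<dots> = (a * d - b * c) * (n \<bullet> (cross3 x y' + cross3 x' y))"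
    by (simp add: cross3_simps)
  finally have *: "e \<bullet> (a *\<^sub>R x' + b *\<^sub>R y') + cross3 n e \<bullet> (c *\<^sub>R x' + d *\<^sub>R y')
    = (a * d - b * c) * (n \<bullet> (cross3 x y' + cross3 x' y))" .
  \<comment> \<open>The frame spans unit area, so the change-of-basis determinant
    \<open>a * d - b * c\<close> is \<open>1 / J\<close>.\<close>
  have "1 = n \<bullet> cross3 e (cross3 n e)"
  proof -
    have "n \<bullet> cross3 e (cross3 n e) = e \<bullet> cross3 (cross3 n e) n"
      by (simp add: cross3_simps)
    then show ?thesis
      using n e by (simp add: cross3_cross3_normal)
  qed
  also have "\<dots> = n \<bullet> cross3 (a *\<^sub>R x + b *\<^sub>R y) (c *\<^sub>R x + d *\<^sub>R y)"
    using ea ec by metis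
  also have "\<dots> = (a * d - b * c) * (n \<bullet> cross3 x y)"
    by (simp add: cross3_simps)
  finally have "(a * d - b * c) * J = 1"
    using xy n by simp
  then show ?thesis
    unfolding * by (metis mult.assoc mult.commute mult.left_neutral)
qed

section \<open>Vector fields with values in a normed space\<close>

text \<open>A common form of \<open>scaleR\<close> and \<open>cscale\<close>, so that one curl
  computation serves the real and the complex fields.\<close>

definition vscale :: "real^'n \<Rightarrow> 'a::real_normed_vector \<Rightarrow> 'a^'n" where
  "vscale v c = (\<chi> i. (v $ i) *\<^sub>R c)"

lemma bounded_bilinear_vscale:
  "bounded_bilinear (vscale :: real^'n \<Rightarrow> 'a::real_normed_vector \<Rightarrow> 'a^'n)"
proof
  show "\<exists>K. \<forall>v c. norm (vscale v c :: 'a^'n) \<le> norm v * norm c * K"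
  proof (intro exI allI)
    fix v :: "real^'n" and c :: 'a
    have "norm (vscale v c :: 'a^'n) = norm v * norm c"
      by (simp add: norm_vec_def vscale_def L2_set_left_distrib)
    then show "norm (vscale v c :: 'a^'n) \<le> norm v * norm c * 1" by simp
  qed
qed (auto simp: vscale_def vec_eq_iff algebra_simps)

lemma vdot_vscale: "vdot a (vscale v c) = (a \<bullet> v) *\<^sub>R c"
  by (simp add: vdot_def vscale_def inner_vec_def scaleR_sum_left)

lemma vdot_add: "vdot a (b + c) = vdot a b + vdot a c"
  by (simp add: vdot_def algebra_simps sum.distrib)

lemma scaleR_eq_vscale: "c *\<^sub>R v = vscale v c"
  by (simp add: vscale_def vec_eq_iff)

lemma cscale_eq_vscale: "cscale c v = vscale v c"
  by (simp add: cscale_def vscale_def vec_eq_iff scaleR_conv_of_real mult.commute)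

lemma vdot_grad:
  assumes "(f has_derivative f') (at x)"
  shows "vdot a (grad f x) = f' a"
proof -
  interpret bounded_linear f' using assms by (rule has_derivative_bounded_linear)
  have "vdot a (grad f x) = (\<Sum>i\<in>UNIV. f' ((a $ i) *\<^sub>R axis i 1))"
    unfolding vdot_def grad_def frechet_derivative_at[OF assms, symmetric] by (simp add: scaleR)
  also have "\<dots> = f' (\<Sum>i\<in>UNIV. (a $ i) *\<^sub>R axis i 1)"
    by (rule sum[symmetric])
  also have "(\<Sum>i\<in>UNIV. (a $ i) *\<^sub>R axis i 1) = a"
    using basis_expansion[of a] by (simp add: scalar_mult_eq_scaleR)
  finally show ?thesis .
qed

lemma has_derivative_radius:
  assumes "y \<noteq> p"
  shows "(radius p has_derivative (\<lambda>d. d \<bullet> (y - p) / radius p y)) (at y)"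
proof -
  have "((\<lambda>y. y - p) has_derivative (\<lambda>d. d)) (at y)"
    by (auto intro!: derivative_eq_intros)
  from has_derivative_compose[OF this has_derivative_norm] show ?thesis
    using assms by (simp add: radius_def[abs_def] sgn_div_norm inner_commute divide_inverse mult.commute)
qed

section \<open>Differential geometry at a point of the surface\<close>

lemma cross_normal_rho_vec: "cross3 (unit_normal X y) (rho_vec X p y) = cross3 (unit_normal X y) (y - p)"
  by (simp add: rho_vec_def cross_add_right cross_mult_right)

lemma f_L_eq: "f_L X p = (\<lambda>y. vscale (cross3 (unit_normal X y) (y - p)) (1 / (4 * pi * (radius p y + height X p y))))"
proof
  fix y
  show "f_L X p y = vscale (cross3 (unit_normal X y) (y - p)) (1 / (4 * pi * (radius p y + height X p y)))"
    unfolding f_L_def rho_tilde_def rho_hat_def cross_mult_right cross_normal_rho_vec[symmetric] scaleR_eq_vscale[symmetric]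
    \<comment> \<open>If \<rho> is zero, so is \<open>rho_vec\<close>, and both sides vanish; the
      identity therefore holds at every point.\<close>
    by (cases "rho X p y = 0") (auto simp: rho_def)
qed

lemma f_L'_eq: "f_L' X p = (\<lambda>y. vscale (cross3 (unit_normal X y) (y - p)) (1 / (4 * pi * radius p y * (radius p y + height X p y))))"
  unfolding f_L'_def[abs_def] f_L_eq scaleR_eq_vscale[symmetric] by (simp add: divide_inverse mult_ac)

text \<open>Moves the reciprocal of \<rho> inside the unit vector into the coefficient, so that only
  \<rho> squared, a polynomial in radius and height, is left to differentiate. For
  \<open>c = 0\<close> both sides are zero.\<close>

lemma vscale_divide_complex:
  fixes x a :: complex
  shows "vscale (v /\<^sub>R c) (x / (a * of_real c)) = vscale v (x / (a * (of_real c)\<^sup>2))"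
proof -
  have "x / (a * (of_real c)\<^sup>2) = inverse c *\<^sub>R (x / (a * of_real c))"
    by (simp add: scaleR_conv_of_real power2_eq_square divide_inverse)
  then show ?thesis
    by (simp only: vscale_def vector_scaleR_component scaleR_scaleR real_scaleR_def mult.commute)
qed

lemma f_H_eq: "f_H k X p = (\<lambda>y. vscale (cross3 (unit_normal X y) (y - p))
    ((exp (\<i> * k * radius p y) - exp (\<i> * k * height X p y)) / (4 * pi * \<i> * k * (complex_of_real (rho X p y))\<^sup>2)))"
  unfolding vscale_divide_complex[symmetric]
  unfolding f_H_def Let_def cscale_eq_vscale rho_tilde_def rho_hat_def cross_mult_right cross_normal_rho_vec
  by simp

lemma f_H'_eq: "f_H' k X p = (\<lambda>y. vscale (cross3 (unit_normal X y) (y - p))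
    ((radius p y * exp (\<i> * k * height X p y) - height X p y * exp (\<i> * k * radius p y))
      / (4 * pi * complex_of_real (radius p y) * (complex_of_real (rho X p y))\<^sup>2)))"
  unfolding vscale_divide_complex[symmetric]
  unfolding f_H'_def Let_def cscale_eq_vscale rho_tilde_def rho_hat_def cross_mult_right cross_normal_rho_vec
  by simp

text \<open>The surface point is represented by its parameter \<open>w\<close>, so that every field
  becomes a function on the triangle; \<open>dn\<close> is the differential of the normal in
  parameter directions.\<close>

locale surface_point =
  fixes S :: "(real^3) set" and X :: "real \<times> real \<Rightarrow> real^3" and w :: "real \<times> real" and p :: "real^3"
  assumes element: "boundary_element S X" and w: "w \<in> ref_triangle"
begin

abbreviation "q \<equiv> X w"
abbreviation "n \<equiv> unit_normal X q"
abbreviation "x \<equiv> \<lambda>d. surf_deriv X d (\<lambda>q. q) q"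
abbreviation "dn \<equiv> \<lambda>d. surf_deriv X d (unit_normal X) q"

lemma inj: "inj_on X ref_triangle"
  using element by (simp add: boundary_element_def)

lemma area_factor_pos: "z \<in> ref_triangle \<Longrightarrow> 0 < area_factor X (X z)"
  using element by (auto simp: boundary_element_def area_factor_def)

lemma cross_tangents: "z \<in> ref_triangle \<Longrightarrow>
    cross3 (tan_u X (X z)) (tan_v X (X z)) = area_factor X (X z) *\<^sub>R unit_normal X (X z)"
  using area_factor_pos by (simp add: unit_normal_def less_imp_neq[symmetric])

lemma normal_unit: "z \<in> ref_triangle \<Longrightarrow> unit_normal X (X z) \<bullet> unit_normal X (X z) = 1"
  using area_factor_pos[of z]
  by (simp add: unit_normal_def area_factor_def dot_square_norm power2_eq_square)

lemma normal_orthogonal: "unit_normal X y \<bullet> tan_u X y = 0" "unit_normal X y \<bullet> tan_v X y = 0"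
  by (simp_all add: unit_normal_def dot_cross_self inner_commute)

lemma has_derivative_normal:
  "((\<lambda>z. unit_normal X (X z)) has_derivative dn) (at w within ref_triangle)"
proof (rule has_derivative_surf_deriv[OF inj w])
  let ?C = "\<lambda>z. cross3 (tan_u X (X z)) (tan_v X (X z))"
  note C = bounded_bilinear.FDERIV[OF bounded_bilinear_cross3 boundary_element_derivatives(2,3)[OF element w]]
  have "?C differentiable (at w within ref_triangle)"
    using C by (rule differentiableI)
  \<comment> \<open>Regularity of the parametrization keeps the cross product away from the origin,
    the one point where the norm is not differentiable.\<close>
  moreover have "?C w \<noteq> 0"
    using area_factor_pos[OF w] by (simp add: area_factor_def)
  ultimately have "(\<lambda>z. norm (?C z)) differentiable (at w within ref_triangle)"
    using differentiable_chain_within[OF _ differentiable_at_withinI[OF differentiable_norm_at]]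
    unfolding comp_def by blast
  then show "(\<lambda>z. unit_normal X (X z)) differentiable (at w within ref_triangle)"
    unfolding unit_normal_def area_factor_def
    using \<open>?C differentiable _\<close> \<open>?C w \<noteq> 0\<close> by (intro differentiable_scaleR differentiable_inverse) auto
qed

lemma normal_dn: "n \<bullet> dn d = 0"
proof -
  have "n \<bullet> dn d + dn d \<bullet> n = 0"
    by (rule has_derivative_constant_triangle[OF w
          has_derivative_inner[OF has_derivative_normal has_derivative_normal] normal_unit])
  then show ?thesis by (simp add: inner_commute)
qed

text \<open>Weingarten's equations, obtained by differentiating the orthogonality of the normal to
  the two tangents.\<close>

lemma dn_tangent:
  "dn d \<bullet> tan_u X q = - (surf_deriv X d (tan_u X) q \<bullet> n)"
  "dn d \<bullet> tan_v X q = - (surf_deriv X d (tan_v X) q \<bullet> n)"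
proof -
  have "n \<bullet> surf_deriv X d (tan_u X) q + dn d \<bullet> tan_u X q = 0"
    by (rule has_derivative_constant_triangle[OF w has_derivative_inner[OF has_derivative_normal
          boundary_element_derivatives(2)[OF element w]] normal_orthogonal(1)])
  then show "dn d \<bullet> tan_u X q = - (surf_deriv X d (tan_u X) q \<bullet> n)"
    by (simp add: inner_commute)
  have "n \<bullet> surf_deriv X d (tan_v X) q + dn d \<bullet> tan_v X q = 0"
    by (rule has_derivative_constant_triangle[OF w has_derivative_inner[OF has_derivative_normal
          boundary_element_derivatives(3)[OF element w]] normal_orthogonal(2)])
  then show "dn d \<bullet> tan_v X q = - (surf_deriv X d (tan_v X) q \<bullet> n)"
    by (simp add: inner_commute)
qed

lemma tangent_coordinates:
  assumes "n \<bullet> t = 0"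
  obtains a b where "t = a *\<^sub>R tan_u X q + b *\<^sub>R tan_v X q"
proof -
  let ?C = "cross3 (tan_u X q) (tan_v X q)"
  have pos: "0 < area_factor X q" using area_factor_pos[OF w] .
  have "t \<bullet> ?C = 0"
    using assms cross_tangents[OF w] by (simp add: inner_commute)
  from cross3_expansion[OF this]
  have "t = inverse ((norm ?C)\<^sup>2) *\<^sub>R ((?C \<bullet> cross3 t (tan_v X q)) *\<^sub>R tan_u X q + (?C \<bullet> cross3 (tan_u X q) t) *\<^sub>R tan_v X q)"
    using pos by (metis area_factor_def less_irrefl scaleR_left_imp_eq[symmetric] scaleR_scaleR
      left_inverse power_not_zero scaleR_one)
  then show ?thesis
    using that by (metis scaleR_add_right scaleR_scaleR)
qed

lemma cross_coordinates:
  assumes "t = a *\<^sub>R tan_u X q + b *\<^sub>R tan_v X q"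
  shows "n \<bullet> cross3 t (tan_v X q) = a * area_factor X q" "n \<bullet> cross3 (tan_u X q) t = b * area_factor X q"
  using cross_tangents[OF w] normal_unit[OF w]
  by (simp_all add: assms cross_add_left cross_add_right cross_mult_left cross_mult_right)

text \<open>Passes from the second fundamental form to the differential of the normal, the form in
  which a trace can be taken. The description by \<open>THE\<close> is well defined because the area
  form determines the coordinates of \<open>t\<close>.\<close>

lemma normal_curvature_eq:
  assumes t: "t = a *\<^sub>R tan_u X q + b *\<^sub>R tan_v X q"
  shows "normal_curvature X q t = - (t \<bullet> (a *\<^sub>R dn (1, 0) + b *\<^sub>R dn (0, 1)))"
proof -
  let ?K = "\<lambda>a b. (du X (tan_u X) q \<bullet> n) * a\<^sup>2 + 2 * (dv X (tan_u X) q \<bullet> n) * a * b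
      + (dv X (tan_v X) q \<bullet> n) * b\<^sup>2"
  have unique: "a' = a \<and> b' = b" if "t = a' *\<^sub>R tan_u X q + b' *\<^sub>R tan_v X q" for a' b'
    using cross_coordinates[OF t] cross_coordinates[OF that] area_factor_pos[OF w] by auto
  have "normal_curvature X q t = ?K a b"
    unfolding normal_curvature_def using t unique by (intro the_equality) auto
  \<comment> \<open>The right side produces each mixed coefficient once, the definition doubles one
    of them; symmetry of second derivatives reconciles the two.\<close>
  also have "\<dots> = - (t \<bullet> (a *\<^sub>R dn (1, 0) + b *\<^sub>R dn (0, 1)))"
    using dn_tangent[of "(1, 0)"] dn_tangent[of "(0, 1)"] boundary_element_derivatives(4)[OF element w]
    by (simp add: t inner_add_left inner_add_right inner_commute[of "dn _"] power2_eq_square algebra_simps)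
  finally show ?thesis .
qed

text \<open>The motion of the point is tangential and contributes nothing; to first order only the
  rotation of the normal changes the height.\<close>

lemma has_derivative_height:
  "((\<lambda>z. height X p (X z)) has_derivative (\<lambda>d. - (dn d \<bullet> (q - p)))) (at w within ref_triangle)"
proof -
  have "((\<lambda>z. unit_normal X (X z) \<bullet> (p - X z)) has_derivative (\<lambda>d. n \<bullet> (0 - x d) + dn d \<bullet> (p - q)))
      (at w within ref_triangle)"
    by (intro has_derivative_inner has_derivative_normal has_derivative_diff has_derivative_const
        boundary_element_derivatives(1)[OF element w])
  moreover have "n \<bullet> x d = 0" for d
  proof -
    interpret bounded_linear x
      using boundary_element_derivatives(1)[OF element w] by (rule has_derivative_bounded_linear)
    have "x d = fst d *\<^sub>R x (1, 0) + snd d *\<^sub>R x (0, 1)"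
      by (simp add: scaleR[symmetric] add[symmetric])
    then show ?thesis
      using normal_orthogonal[of q] by (simp add: tan_u_def tan_v_def inner_add_right)
  qed
  ultimately show ?thesis
    by (simp add: height_def inner_diff_right)
qed

lemma rho_vec_orthogonal: "z \<in> ref_triangle \<Longrightarrow> unit_normal X (X z) \<bullet> rho_vec X p (X z) = 0"
  using normal_unit[of z]
  by (simp add: rho_vec_def height_def inner_add_right inner_diff_right)

lemma rho_squared: "z \<in> ref_triangle \<Longrightarrow> (rho X p (X z))\<^sup>2 = (radius p (X z))\<^sup>2 - (height X p (X z))\<^sup>2"
proof -
  assume "z \<in> ref_triangle"
  define N d where "N = unit_normal X (X z)" and "d = X z - p"
  have "N \<bullet> N = 1" using normal_unit[OF \<open>z \<in> _\<close>] by (simp add: N_def)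
  moreover have h: "height X p (X z) = - (N \<bullet> d)"
    by (simp add: height_def N_def d_def inner_diff_right)
  moreover have "rho_vec X p (X z) = d - (N \<bullet> d) *\<^sub>R N"
    by (simp add: rho_vec_def h d_def N_def)
  ultimately show ?thesis
    by (simp add: rho_def radius_def power2_norm_eq_inner d_def[symmetric] inner_diff_left inner_diff_right
        inner_commute[of d N]) (simp add: power2_eq_square)
qed

text \<open>Here \<open>a\<close> and \<open>b\<close> are the partial derivatives of the density in
  radius and height. The product rule splits the curl into the curl of \<open>n \<times> R\<close>
  times the density (\<open>s1\<close>), a radial part (\<open>s2\<close>) and a height part
  (\<open>s3\<close>).\<close>

lemma surface_curl_vscale:
  assumes "rho_vec X p q \<noteq> 0"
    and \<phi>: "((\<lambda>z. \<phi> (X z)) has_derivative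
      (\<lambda>d. (x d \<bullet> (q - p) / radius p q) *\<^sub>R a + (- (dn d \<bullet> (q - p))) *\<^sub>R b)) (at w within ref_triangle)"
  shows "surface_curl X (\<lambda>y. vscale (cross3 (unit_normal X y) (y - p)) (\<phi> y)) q
    = (2 - height X p q * (normal_curvature X q (rho_tilde X p q) + normal_curvature X q (rho_hat X p q))) *\<^sub>R \<phi> q
      + ((rho X p q)\<^sup>2 / radius p q) *\<^sub>R a + ((rho X p q)\<^sup>2 * normal_curvature X q (rho_hat X p q)) *\<^sub>R b"
proof -
  define U V J h R P e where "U = tan_u X q" and "V = tan_v X q" and "J = area_factor X q"
    and "h = height X p q" and "R = q - p" and "P = rho_vec X p q" and "e = rho_hat X p q"
  let ?A = "dn (1, 0)" and ?B = "dn (0, 1)" and ?\<rho> = "rho X p q" and ?r = "radius p q"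
  have xU: "x (1, 0) = U" "x (0, 1) = V"
    by (simp_all add: U_def V_def tan_u_def tan_v_def)
  have J: "0 < J" using area_factor_pos[OF w] by (simp add: J_def)
  have UV: "cross3 U V = J *\<^sub>R n" using cross_tangents[OF w] by (simp add: U_def V_def J_def)
  have nn: "n \<bullet> n = 1" using normal_unit[OF w] .
  have nU: "n \<bullet> U = 0" "n \<bullet> V = 0" using normal_orthogonal[of q] by (simp_all add: U_def V_def)
  have \<rho>: "0 < ?\<rho>" using assms(1) by (simp add: rho_def)
  have Pe: "P = ?\<rho> *\<^sub>R e" using \<rho> by (simp add: P_def e_def rho_hat_def)
  have nP: "n \<bullet> P = 0" using rho_vec_orthogonal[OF w] by (simp add: P_def)
  have ee: "n \<bullet> e = 0" "e \<bullet> e = 1"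
    using nP \<rho> by (simp_all add: Pe) (simp add: e_def rho_hat_def rho_def dot_square_norm power2_eq_square)
  have tilde: "rho_tilde X p q = cross3 n e" by (simp add: rho_tilde_def e_def)
  have RP: "R = P - h *\<^sub>R n" by (simp add: R_def P_def h_def rho_vec_def)
  obtain a1 b1 where e: "e = a1 *\<^sub>R U + b1 *\<^sub>R V"
    using tangent_coordinates[OF ee(1)] unfolding U_def V_def .
  obtain a2 b2 where e': "cross3 n e = a2 *\<^sub>R U + b2 *\<^sub>R V"
    using tangent_coordinates[of "cross3 n e"] dot_cross_self(1)[of n e] unfolding U_def V_def by metis
  define k k' where "k = normal_curvature X q e" and "k' = normal_curvature X q (cross3 n e)"
  have k: "k = - (e \<bullet> (a1 *\<^sub>R ?A + b1 *\<^sub>R ?B))"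
    using normal_curvature_eq[of e a1 b1] e by (simp add: k_def U_def V_def)
  have k': "k' = - (cross3 n e \<bullet> (a2 *\<^sub>R ?A + b2 *\<^sub>R ?B))"
    using normal_curvature_eq[of "cross3 n e" a2 b2] e' by (simp add: k'_def U_def V_def)
  \<comment> \<open>Minus the sum of the two normal curvatures is the trace of the differential of
    the normal.\<close>
  have tr: "n \<bullet> (cross3 U ?B + cross3 ?A V) = - J * (k + k')"
    using trace_in_orthonormal_frame[OF nn UV ee e e', where x' = ?A and y' = ?B] by (simp add: k k' algebra_simps)
  \<comment> \<open>Split \<open>R\<close> into its tangential part \<open>P\<close> and its normal
    part: \<open>P\<close> gives only determinants of coplanar vectors, the normal part gives
    \<open>h\<close> times the trace, and the derivative of the position gives the
    \<open>2\<close>.\<close>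
  have s1: "V \<bullet> (cross3 n U + cross3 ?A R) - U \<bullet> (cross3 n V + cross3 ?B R) = J * (2 - h * (k' + k))"
  proof -
    have "V \<bullet> (cross3 n U + cross3 ?A R) - U \<bullet> (cross3 n V + cross3 ?B R)
        = 2 * (n \<bullet> cross3 U V) + P \<bullet> cross3 V ?A - P \<bullet> cross3 U ?B + h * (n \<bullet> (cross3 U ?B + cross3 ?A V))"
      unfolding RP by (simp add: cross3_simps)
    moreover have "P \<bullet> cross3 V ?A = 0" "P \<bullet> cross3 U ?B = 0"
      using triple_product_coplanar[OF nn nP] nU normal_dn by auto
    ultimately show ?thesis
      unfolding tr using UV nn by (simp add: algebra_simps)
  qed
  have nR: "cross3 n R = cross3 n P" by (simp add: RP Cross3.right_diff_distrib cross_mult_right)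
  \<comment> \<open>Pairing \<open>n \<times> R\<close> with the tangents reads off the coordinates
    of \<open>P\<close>, which is \<rho> times \<open>e\<close>; the parts \<open>s2\<close> and
    \<open>s3\<close> then recombine these coordinates into a derivative in direction
    \<open>e\<close>.\<close>
  have VnR: "V \<bullet> cross3 n R = ?\<rho> * a1 * J" 
  proof -
    have "V \<bullet> cross3 n R = n \<bullet> cross3 P V" unfolding nR by (simp add: cross3_simps)
    then show ?thesis
      using cross_coordinates(1)[of e a1 b1] e by (simp add: Pe cross_mult_left U_def V_def J_def)
  qed
  have UnR: "U \<bullet> cross3 n R = - (?\<rho> * b1 * J)" 
  proof -
    have "U \<bullet> cross3 n R = - (n \<bullet> cross3 U P)" unfolding nR by (simp add: cross3_simps)
    then show ?thesis
      using cross_coordinates(2)[of e a1 b1] e by (simp add: Pe cross_mult_right U_def V_def J_def)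
  qed
  have s2: "(V \<bullet> cross3 n R) * (U \<bullet> R / ?r) - (U \<bullet> cross3 n R) * (V \<bullet> R / ?r) = J * (?\<rho>\<^sup>2 / ?r)"
  proof -
    have "(V \<bullet> cross3 n R) * (U \<bullet> R / ?r) - (U \<bullet> cross3 n R) * (V \<bullet> R / ?r) = J * ?\<rho> * (e \<bullet> R) / ?r"
      unfolding VnR UnR by (subst e) (simp add: inner_add_left algebra_simps add_divide_distrib)
    also have "e \<bullet> R = ?\<rho>"
      using ee by (simp add: RP Pe inner_diff_right inner_commute)
    finally show ?thesis by (simp add: power2_eq_square)
  qed
  have s3: "(V \<bullet> cross3 n R) * (- (?A \<bullet> R)) - (U \<bullet> cross3 n R) * (- (?B \<bullet> R)) = J * (?\<rho>\<^sup>2 * k)"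
  proof -
    have "?A \<bullet> R = ?\<rho> * (e \<bullet> ?A)" "?B \<bullet> R = ?\<rho> * (e \<bullet> ?B)"
      using normal_dn by (simp_all add: RP Pe inner_diff_right inner_commute)
    then show ?thesis
      unfolding VnR UnR k by (simp add: inner_add_right power2_eq_square algebra_simps)
  qed
  let ?F = "\<lambda>d. vscale (cross3 n R) ((x d \<bullet> R / ?r) *\<^sub>R a + (- (dn d \<bullet> R)) *\<^sub>R b)
      + vscale (cross3 n (x d) + cross3 (dn d) R) (\<phi> q)"
  have "((\<lambda>z. cross3 (unit_normal X (X z)) (X z - p)) has_derivative (\<lambda>d. cross3 n (x d - 0) + cross3 (dn d) (q - p)))
      (at w within ref_triangle)"
    by (intro bounded_bilinear.FDERIV[OF bounded_bilinear_cross3] has_derivative_normal has_derivative_diff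
        has_derivative_const boundary_element_derivatives(1)[OF element w])
  from bounded_bilinear.FDERIV[OF bounded_bilinear_vscale this \<phi>]
  have "((\<lambda>z. vscale (cross3 (unit_normal X (X z)) (X z - p)) (\<phi> (X z))) has_derivative ?F) (at w within ref_triangle)"
    by (simp add: R_def)
  note F = surf_deriv_eq[OF inj w this]
  have "surface_curl X (\<lambda>y. vscale (cross3 (unit_normal X y) (y - p)) (\<phi> y)) q
      = (vdot V (?F (1, 0)) - vdot U (?F (0, 1))) /\<^sub>R J"
    by (simp only: surface_curl_def F U_def[symmetric] V_def[symmetric] J_def[symmetric])
  also have "\<dots> = ((V \<bullet> (cross3 n U + cross3 ?A R) - U \<bullet> (cross3 n V + cross3 ?B R)) *\<^sub>R \<phi> q
      + ((V \<bullet> cross3 n R) * (U \<bullet> R / ?r) - (U \<bullet> cross3 n R) * (V \<bullet> R / ?r)) *\<^sub>R a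
      + ((V \<bullet> cross3 n R) * (- (?A \<bullet> R)) - (U \<bullet> cross3 n R) * (- (?B \<bullet> R))) *\<^sub>R b) /\<^sub>R J"
    unfolding xU vdot_add vdot_vscale by (simp add: algebra_simps)
  also have "\<dots> = (2 - h * (k' + k)) *\<^sub>R \<phi> q + (?\<rho>\<^sup>2 / ?r) *\<^sub>R a + (?\<rho>\<^sup>2 * k) *\<^sub>R b"
    unfolding s1 s2 s3 using J by (simp add: scaleR_add_right mult.assoc[symmetric])
  finally show ?thesis
    by (simp add: h_def k_def k'_def tilde e_def)
qed

text \<open>The strict inequality keeps the denominators built from \<open>r\<close>,
  \<open>r + h\<close> and \<open>r\<^sup>2 - h\<^sup>2\<close> away from zero.\<close>

lemma height_less_radius:
  assumes "rho_vec X p q \<noteq> 0"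
  shows "\<bar>height X p q\<bar> < radius p q"
proof -
  have "0 < (rho X p q)\<^sup>2" using assms by (simp add: rho_def)
  then have "(height X p q)\<^sup>2 < (radius p q)\<^sup>2" using rho_squared[OF w] by simp
  then show ?thesis
    using power2_less_imp_less[of "\<bar>height X p q\<bar>" "radius p q"] by (simp add: radius_def)
qed


section \<open>Evaluation for the Laplace and Helmholtz kernels\<close>

lemma radial_derivatives:
  assumes "rho_vec X p q \<noteq> 0"
  shows "((\<lambda>z. radius p (X z)) has_derivative (\<lambda>d. x d \<bullet> (q - p) / radius p q)) (at w within ref_triangle)"
    and "((\<lambda>z. height X p (X z)) has_derivative (\<lambda>d. - (dn d \<bullet> (q - p)))) (at w within ref_triangle)"
proof -
  have "q \<noteq> p" using height_less_radius[OF assms] by (auto simp: radius_def)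
  from has_derivative_compose[OF boundary_element_derivatives(1)[OF element w] has_derivative_radius[OF this]]
  show "((\<lambda>z. radius p (X z)) has_derivative (\<lambda>d. x d \<bullet> (q - p) / radius p q)) (at w within ref_triangle)" .
qed (rule has_derivative_height)

text \<open>Chain rule: the derivative of the radius along the normal is
  \<open>n \<bullet> (q - p) / r\<close>, which is \<open>- h / r\<close>.\<close>

lemma normal_deriv_radial:
  assumes "rho_vec X p q \<noteq> 0"
    and g: "(g has_derivative (\<lambda>s. s *\<^sub>R g')) (at (radius p q))"
  shows "normal_deriv X (\<lambda>y. g (radius p y)) q = (- height X p q / radius p q) *\<^sub>R g'"
proof -
  have "q \<noteq> p" using height_less_radius[OF assms(1)] by (auto simp: radius_def)
  from has_derivative_compose[OF has_derivative_radius[OF this] g] show ?thesis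
    unfolding normal_deriv_def by (simp add: vdot_grad height_def inner_diff_right)
qed

lemma laplace:
  assumes "rho_vec X p q \<noteq> 0"
  shows "G_L p q = surface_curl X (f_L X p) q
          + 1 / (4 * pi) * (C_L X p q * normal_curvature X q (rho_tilde X p q)
                          + D_L X p q * normal_curvature X q (rho_hat X p q))" (is ?potential)
    and "normal_deriv X (G_L p) q = surface_curl X (f_L' X p) q
          + 1 / (4 * pi) * (C_L' X p q * normal_curvature X q (rho_tilde X p q)
                          + D_L' X p q * normal_curvature X q (rho_hat X p q))" (is ?derivative)
proof -
  define r h s k k' where "r = radius p q" and "h = height X p q" and "s = r + h"
    and "k = normal_curvature X q (rho_hat X p q)" and "k' = normal_curvature X q (rho_tilde X p q)"
  have "\<bar>h\<bar> < r" using height_less_radius[OF assms] by (simp add: h_def r_def)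
  then have r: "r \<noteq> 0" and s: "s \<noteq> 0" by (auto simp: s_def)
  \<comment> \<open>With \<open>s = r + h\<close>, the square of \<rho> factors as
    \<open>s * (2 * r - s)\<close> and cancels one \<open>s\<close> in the denominators.\<close>
  have h: "h = s - r" by (simp add: s_def)
  have \<rho>: "(rho X p q)\<^sup>2 = s * (2 * r - s)"
    using rho_squared[OF w] by (simp add: s_def r_def h_def power2_eq_square algebra_simps)
  note D = radial_derivatives[OF assms]
  have nz: "radius p q \<noteq> 0" "radius p q + height X p q \<noteq> 0"
    using r s by (simp_all add: s_def r_def h_def)
  define c where "c = 1 / (4 * pi * s)"
  have "surface_curl X (f_L X p) q = (2 - h * (k' + k)) * c
      + s * (2 * r - s) / r * (- 1 / (4 * pi * s\<^sup>2)) + s * (2 * r - s) * k * (- 1 / (4 * pi * s\<^sup>2))"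
    unfolding f_L_eq using surface_curl_vscale[OF assms laplace_density_derivative[OF D nz(2)]]
    by (simp only: \<rho> r_def[symmetric] h_def[symmetric] s_def[symmetric] k_def[symmetric] k'_def[symmetric]
        c_def[symmetric] real_scaleR_def)
  \<comment> \<open>The radial part is the kernel minus twice the density \<open>c\<close>, which
    cancels the \<open>2\<close> of the curl formula; only curvature terms remain beside the
    kernel.\<close>
  also have "s * (2 * r - s) / r * (- 1 / (4 * pi * s\<^sup>2)) = G_L p q - 2 * c"
    using r s unfolding G_L_def r_def[symmetric] c_def
    by (simp add: divide_simps power2_eq_square; simp add: algebra_simps)
  also have "s * (2 * r - s) * k * (- 1 / (4 * pi * s\<^sup>2)) = k * (h - r) * c"
    using s unfolding h c_def by (simp add: divide_simps power2_eq_square; simp add: algebra_simps)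
  finally have curl: "surface_curl X (f_L X p) q = (2 - h * (k' + k)) * c + (G_L p q - 2 * c) + k * (h - r) * c" .
  have curvature: "1 / (4 * pi) * (C_L X p q * k' + D_L X p q * k) = (h * k' + r * k) * c"
    unfolding C_L_def D_L_def r_def[symmetric] h_def[symmetric] s_def[symmetric] c_def
    using s by (simp add: divide_simps)
  show ?potential
    unfolding k_def[symmetric] k'_def[symmetric] curl curvature by (simp add: algebra_simps)
  define c' where "c' = 1 / (4 * pi * r * s)"
  have "surface_curl X (f_L' X p) q = (2 - h * (k' + k)) * c'
      + s * (2 * r - s) / r * (- (2 * r + h) / (4 * pi * r\<^sup>2 * s\<^sup>2)) + s * (2 * r - s) * k * (- 1 / (4 * pi * r * s\<^sup>2))"
    unfolding f_L'_eq using surface_curl_vscale[OF assms laplace_normal_density_derivative[OF D nz]]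
    by (simp only: \<rho> r_def[symmetric] h_def[symmetric] s_def[symmetric] k_def[symmetric] k'_def[symmetric]
        c'_def[symmetric] real_scaleR_def)
  \<comment> \<open>Again the kernel minus twice the density: \<open>h / (4 * pi * r ^ 3)\<close> is
    the normal derivative of \<open>G_L\<close>, as shown below.\<close>
  also have "s * (2 * r - s) / r * (- (2 * r + h) / (4 * pi * r\<^sup>2 * s\<^sup>2)) = h / (4 * pi * r ^ 3) - 2 * c'"
    using r s unfolding h c'_def
    by (simp add: divide_simps power2_eq_square power3_eq_cube; simp add: algebra_simps)
  also have "s * (2 * r - s) * k * (- 1 / (4 * pi * r * s\<^sup>2)) = k * (h - r) * c'"
    using r s unfolding h c'_def by (simp add: divide_simps power2_eq_square; simp add: algebra_simps)
  finally have curl': "surface_curl X (f_L' X p) q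
      = (2 - h * (k' + k)) * c' + (h / (4 * pi * r ^ 3) - 2 * c') + k * (h - r) * c'" .
  have curvature': "1 / (4 * pi) * (C_L' X p q * k' + D_L' X p q * k) = (h * k' + r * k) * c'"
    unfolding C_L'_def D_L'_def C_L_def D_L_def r_def[symmetric] h_def[symmetric] s_def[symmetric] c'_def
    using r s by (simp add: divide_simps)
  have "((\<lambda>r. 1 / (4 * pi * r)) has_derivative (\<lambda>s. s *\<^sub>R (- 1 / (4 * pi * r\<^sup>2)))) (at r)"
    using r by (auto intro!: derivative_eq_intros simp: divide_simps power2_eq_square)
  then have "normal_deriv X (G_L p) q = h / (4 * pi * r ^ 3)"
    using normal_deriv_radial[OF assms, of "\<lambda>r. 1 / (4 * pi * r)" "- 1 / (4 * pi * r\<^sup>2)", folded r_def h_def]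
    by (simp add: G_L_def[abs_def] power3_eq_cube power2_eq_square)
  then show ?derivative
    unfolding k_def[symmetric] k'_def[symmetric] curl' curvature' by (simp add: algebra_simps)
qed

lemma helmholtz:
  assumes "rho_vec X p q \<noteq> 0" "\<kappa> \<noteq> 0"
  shows "G_H \<kappa> p q = surface_curl X (f_H \<kappa> X p) q
          + 1 / (4 * complex_of_real pi)
            * (C_H \<kappa> X p q * complex_of_real (normal_curvature X q (rho_tilde X p q))
             + D_H \<kappa> X p q * complex_of_real (normal_curvature X q (rho_hat X p q)))" (is ?potential)
    and "normal_deriv X (G_H \<kappa> p) q = surface_curl X (f_H' \<kappa> X p) q
          + 1 / (4 * complex_of_real pi)
            * (C_H' \<kappa> X p q * complex_of_real (normal_curvature X q (rho_tilde X p q))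
             + D_H' \<kappa> X p q * complex_of_real (normal_curvature X q (rho_hat X p q)))" (is ?derivative)
proof -
  define r h k k' E H m where "r = complex_of_real (radius p q)" and "h = complex_of_real (height X p q)"
    and "k = complex_of_real (normal_curvature X q (rho_hat X p q))"
    and "k' = complex_of_real (normal_curvature X q (rho_tilde X p q))"
    and "E = exp (\<i> * \<kappa> * r)" and "H = exp (\<i> * \<kappa> * h)"
    and "m = complex_of_real ((radius p q)\<^sup>2 - (height X p q)\<^sup>2)"
  have less: "\<bar>height X p q\<bar> < radius p q" using height_less_radius[OF assms(1)] .
  then have r: "r \<noteq> 0" by (auto simp: r_def)
  have ne: "radius p q \<noteq> 0" "(radius p q)\<^sup>2 \<noteq> (height X p q)\<^sup>2"
    using less by (auto simp: power2_eq_iff)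
  then have m: "m \<noteq> 0" unfolding m_def of_real_eq_0_iff by simp
  have m_sq: "m = r\<^sup>2 - h\<^sup>2" by (simp add: m_def r_def h_def)
  have \<rho>: "(complex_of_real (rho X p q))\<^sup>2 = m"
    unfolding m_def of_real_power[symmetric] rho_squared[OF w] ..
  \<comment> \<open>Needed on the whole triangle, since the square of \<rho> is replaced inside a
    function that is differentiated.\<close>
  have \<rho>_within: "(complex_of_real (rho X p (X z)))\<^sup>2 = complex_of_real ((radius p (X z))\<^sup>2 - (height X p (X z))\<^sup>2)"
    if "z \<in> ref_triangle" for z
    unfolding of_real_power[symmetric] rho_squared[OF that] ..
  have coeff: "complex_of_real (2 - height X p q * (normal_curvature X q (rho_tilde X p q)
      + normal_curvature X q (rho_hat X p q))) = 2 - h * (k' + k)"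
    by (simp add: h_def k_def k'_def)
  note [simp del] = of_real_power of_real_diff
  note D = radial_derivatives[OF assms(1)]
  define a b c where "a = (\<i> * \<kappa> * E / m - 2 * r * (E - H) / m\<^sup>2) / (4 * pi * \<i> * \<kappa>)"
    and "b = (2 * h * (E - H) / m\<^sup>2 - \<i> * \<kappa> * H / m) / (4 * pi * \<i> * \<kappa>)"
    and "c = (E - H) / (4 * pi * \<i> * \<kappa> * m)"
  have "((\<lambda>z. (exp (\<i> * \<kappa> * radius p (X z)) - exp (\<i> * \<kappa> * height X p (X z)))
        / (4 * pi * \<i> * \<kappa> * (complex_of_real (rho X p (X z)))\<^sup>2))
      has_derivative (\<lambda>d. (x d \<bullet> (q - p) / radius p q) *\<^sub>R a + (- (dn d \<bullet> (q - p))) *\<^sub>R b)) (at w within ref_triangle)"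
    by (rule has_derivative_transform[OF w _ helmholtz_density_derivative[OF D assms(2) ne(2),
          folded r_def h_def m_def, folded E_def H_def, folded a_def b_def]])
      (simp only: \<rho>_within)
  from surface_curl_vscale[OF assms(1) this]
  have "surface_curl X (f_H \<kappa> X p) q = (2 - h * (k' + k)) * c + m / r * a + m * k * b"
    unfolding f_H_eq by (simp add: scaleR_conv_of_real rho_squared[OF w] \<rho>_within[OF w] coeff)
      (simp add: r_def h_def k_def k'_def E_def H_def m_def c_def)
  also have "m / r * a = G_H \<kappa> p q - 2 * c"
    unfolding G_H_def Let_def r_def[symmetric] E_def[symmetric]
    using r m assms(2) by (simp add: a_def c_def divide_simps power2_eq_square; simp add: algebra_simps)
  \<comment> \<open>Together with \<open>- h * k * c\<close> from the first term this leaves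
    \<open>(h * c - H / (4 * pi)) * k\<close>, the negative of the \<open>D_H\<close>
    contribution.\<close>
  also have "m * k * b = 2 * h * k * c - H / (4 * pi) * k"
    using r m assms(2) by (simp add: b_def c_def divide_simps power2_eq_square; simp add: algebra_simps)
  finally have curl: "surface_curl X (f_H \<kappa> X p) q
      = (2 - h * (k' + k)) * c + (G_H \<kappa> p q - 2 * c) + (2 * h * k * c - H / (4 * pi) * k)" .
  have curvature: "1 / (4 * complex_of_real pi) * (C_H \<kappa> X p q * k' + D_H \<kappa> X p q * k)
      = h * c * k' + (H / (4 * pi) - h * c) * k"
    unfolding C_H_def D_H_def Let_def r_def[symmetric] h_def[symmetric] E_def[symmetric] H_def[symmetric] \<rho> c_def
    using m assms(2) by (simp add: divide_simps; simp add: algebra_simps)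
  show ?potential
    unfolding k_def[symmetric] k'_def[symmetric] curl curvature by (simp add: algebra_simps)
  define K where "K = r * H - h * E"
  \<comment> \<open>\<open>c'\<close> is the density, \<open>a'\<close> and \<open>b'\<close> are
    its partial derivatives, and \<open>g\<close> is the share of the height part that comes from
    differentiating the numerator \<open>K\<close>.\<close>
  define a' b' c' g where "a' = (h * E * (1 - \<i> * \<kappa> * r) * m - 2 * r\<^sup>2 * K) / (4 * pi * r\<^sup>2 * m\<^sup>2)"
    and "b' = ((\<i> * \<kappa> * r * H - E) * m + 2 * h * K) / (4 * pi * r * m\<^sup>2)"
    and "c' = K / (4 * pi * r * m)"
    and "g = (\<i> * \<kappa> * r * H - E) / (4 * pi * r)"
  have "((\<lambda>z. (radius p (X z) * exp (\<i> * \<kappa> * height X p (X z)) - height X p (X z) * exp (\<i> * \<kappa> * radius p (X z)))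
        / (4 * pi * complex_of_real (radius p (X z)) * (complex_of_real (rho X p (X z)))\<^sup>2))
      has_derivative (\<lambda>d. (x d \<bullet> (q - p) / radius p q) *\<^sub>R a' + (- (dn d \<bullet> (q - p))) *\<^sub>R b')) (at w within ref_triangle)"
    by (rule has_derivative_transform[OF w _ helmholtz_normal_density_derivative[OF D ne, of \<kappa>,
          folded r_def h_def m_def, folded E_def H_def, folded K_def, folded a'_def b'_def]])
      (simp only: \<rho>_within)
  from surface_curl_vscale[OF assms(1) this]
  have "surface_curl X (f_H' \<kappa> X p) q = (2 - h * (k' + k)) * c' + m / r * a' + m * k * b'"
    unfolding f_H'_eq by (simp add: scaleR_conv_of_real rho_squared[OF w] \<rho>_within[OF w] coeff)
      (simp add: r_def h_def k_def k'_def E_def H_def m_def K_def c'_def)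
  also have "m / r * a' = h * E * (1 - \<i> * \<kappa> * r) / (4 * pi * r ^ 3) - 2 * c'"
    using r m by (simp add: a'_def c'_def divide_simps power2_eq_square power3_eq_cube; simp add: algebra_simps)
  also have "m * k * b' = k * g + 2 * h * k * c'"
    using r m by (simp add: b'_def c'_def g_def divide_simps power2_eq_square; simp add: algebra_simps)
  finally have curl': "surface_curl X (f_H' \<kappa> X p) q = (2 - h * (k' + k)) * c'
      + (h * E * (1 - \<i> * \<kappa> * r) / (4 * pi * r ^ 3) - 2 * c') + (k * g + 2 * h * k * c')" .
  have curvature': "1 / (4 * complex_of_real pi) * (C_H' \<kappa> X p q * k' + D_H' \<kappa> X p q * k)
      = h * c' * k' - (h * c' + g) * k"
  proof -
    \<comment> \<open>Substituting \<open>K\<close> and \<open>m = r\<^sup>2 - h\<^sup>2\<close>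
      rewrites the numerator in \<open>D_H'\<close> so that the coefficient becomes
      \<open>- (4 * pi * (h * c' + g))\<close>, the quantities that occur in the curl.\<close>
    have "r * E - h * H = - (h * K) / r + m * (E / r)"
      using r by (simp add: divide_simps) (simp add: K_def m_sq algebra_simps power2_eq_square)
    then have "(r * E - h * H) / m - \<i> * \<kappa> * H = - (h * K / (r * m)) - (\<i> * \<kappa> * r * H - E) / r"
      using r m by (simp add: add_divide_distrib diff_divide_distrib)
    moreover have "C_H' \<kappa> X p q = h * K / (r * m)" "D_H' \<kappa> X p q = (r * E - h * H) / m - \<i> * \<kappa> * H"
      by (simp_all add: C_H'_def D_H'_def Let_def E_def H_def h_def r_def K_def \<rho>)
    moreover have "h * K / (r * m) = 4 * pi * (h * c')" "(\<i> * \<kappa> * r * H - E) / r = 4 * pi * g"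
      by (simp_all add: c'_def g_def)
    ultimately have CD: "C_H' \<kappa> X p q = 4 * pi * (h * c')" "D_H' \<kappa> X p q = - (4 * pi * (h * c' + g))"
      by (simp_all add: distrib_left)
    show ?thesis
      unfolding CD by (simp add: field_simps)
  qed
  have "normal_deriv X (G_H \<kappa> p) q = h * E * (1 - \<i> * \<kappa> * r) / (4 * pi * r ^ 3)"
  proof -
    have "((\<lambda>t. exp (\<i> * \<kappa> * complex_of_real t) / (4 * pi * complex_of_real t))
        has_derivative (\<lambda>s. (of_real s * (\<i> * \<kappa> * E) * (4 * pi * r) - E * (4 * pi * complex_of_real s)) / (4 * pi * r * (4 * pi * r))))
        (at (radius p q))"
      using r unfolding E_def r_def
      by (intro has_derivative_divide' has_derivative_exp_of_real has_derivative_mult_right has_derivative_of_real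
          has_derivative_ident) auto
    moreover have "(of_real s * (\<i> * \<kappa> * E) * (4 * pi * r) - E * (4 * pi * complex_of_real s)) / (4 * pi * r * (4 * pi * r))
        = s *\<^sub>R (E * (\<i> * \<kappa> * r - 1) / (4 * pi * r\<^sup>2))" for s
      using r by (simp add: scaleR_conv_of_real divide_simps power2_eq_square; simp add: algebra_simps)
    ultimately have "((\<lambda>t. exp (\<i> * \<kappa> * complex_of_real t) / (4 * pi * complex_of_real t))
        has_derivative (\<lambda>s. s *\<^sub>R (E * (\<i> * \<kappa> * r - 1) / (4 * pi * r\<^sup>2)))) (at (radius p q))"
      by simp
    from normal_deriv_radial[OF assms(1) this]
    have "normal_deriv X (G_H \<kappa> p) q = - h / r * (E * (\<i> * \<kappa> * r - 1) / (4 * pi * r\<^sup>2))"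
      by (simp add: G_H_def[abs_def] Let_def scaleR_conv_of_real h_def r_def)
    then show ?thesis
      using r by (simp add: divide_simps power2_eq_square power3_eq_cube; simp add: algebra_simps)
  qed
  then show ?derivative
    unfolding k_def[symmetric] k'_def[symmetric] curl' curvature' by (simp add: algebra_simps)
qed

end


theorem proposition1:
  fixes S :: "(real^3) set" and X :: "real \<times> real \<Rightarrow> real^3"
    and p q :: "real^3" and k :: complex
  assumes "boundary_element S X"
    and "k \<noteq> 0"
    and "q \<in> S"
    and "rho_vec X p q \<noteq> 0"
  shows "(G_L p q = surface_curl X (f_L X p) q
          + 1 / (4 * pi) * (C_L X p q * normal_curvature X q (rho_tilde X p q)
                          + D_L X p q * normal_curvature X q (rho_hat X p q)))
     \<and> (normal_deriv X (G_L p) q = surface_curl X (f_L' X p) q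
          + 1 / (4 * pi) * (C_L' X p q * normal_curvature X q (rho_tilde X p q)
                          + D_L' X p q * normal_curvature X q (rho_hat X p q)))
     \<and> (G_H k p q = surface_curl X (f_H k X p) q
          + 1 / (4 * complex_of_real pi)
            * (C_H k X p q * complex_of_real (normal_curvature X q (rho_tilde X p q))
             + D_H k X p q * complex_of_real (normal_curvature X q (rho_hat X p q))))
     \<and> (normal_deriv X (G_H k p) q = surface_curl X (f_H' k X p) q
          + 1 / (4 * complex_of_real pi)
            * (C_H' k X p q * complex_of_real (normal_curvature X q (rho_tilde X p q))
             + D_H' k X p q * complex_of_real (normal_curvature X q (rho_hat X p q))))"
proof -
  obtain z where z: "z \<in> ref_triangle" "q = X z"
    using assms(1,3) by (auto simp: boundary_element_def)
  interpret surface_point S X z p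
    using assms(1) z(1) by unfold_locales
  show ?thesis
    using assms(2,4) unfolding z(2) by (intro conjI laplace helmholtz)
qed

end
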